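(* Let $\alpha_1,\alpha_2>0$ and $\mu_j\in\mathcal M_{\alpha_j}(\mathbb R)$, $j=1,2$, and suppose that $J_{\alpha_1,\alpha_2}[\mu_1,\mu_2]<\infty$ and $J_{\alpha_2,\alpha_1}[\mu_2,\mu_1]<\infty$. Then $$C_{\alpha_1}[\mu_1](z)\,C_{\alpha_2}[\mu_2](z)=C_{\alpha_1+\alpha_2}[\mu](z),\qquad z\in\mathbb C^+,$$ with $\mu\in\mathcal M_{\alpha_1+\alpha_2}(\mathbb R)$ given by $\mu(d\tau)=u(\tau)\,d\tau+\mu_1(\{\tau\})\mu_2(d\tau)$, where for almost all $\tau\in\mathbb R$ $$B(\alpha_1,\alpha_2)u(\tau)=\int_{(\tau,\infty)}\int_{(-\infty,\tau)}\frac{(\tau-s)^{\alpha_2-1}(t-\tau)^{\alpha_1-1}}{(t-s)^{\alpha_1+\alpha_2-1}}\mu_1(ds)\mu_2(dt)+\int_{(\tau,\infty)}\int_{(-\infty,\tau)}\frac{(\tau-s)^{\alpha_1-1}(t-\tau)^{\alpha_2-1}}{(t-s)^{\alpha_1+\alpha_2-1}}\mu_2(ds)\mu_1(dt).$$ Moreover, such a $\mu$ is positive if $\mu_1$ and $\mu_2$ are positive.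
   Context: $\mathbb C^+=\{z:\operatorname{Im}z>0\}$. For $\alpha\ge0$, $\mathcal M_\alpha(\mathbb R)$ is the space of complex Radon measures $\mu$ on $\mathbb R$ with $\int_{\mathbb R}(1+|t|)^{-\alpha}|\mu|(dt)<\infty$. For $\alpha>0$, the generalized Cauchy transform is $C_\alpha[\mu](z)=\int_{\mathbb R}\frac{\mu(dt)}{(z+t)^\alpha}$, $z\in\mathbb C^+$ (principal branch of the power). $B$ is the beta function. For $\mu_1\in\mathcal M_{\alpha_1}(\mathbb R)$, $\mu_2\in\mathcal M_{\alpha_2}(\mathbb R)$, $$J_{\alpha_1,\alpha_2}[\mu_1,\mu_2]=\int_{\mathbb R}\int_{(-\infty,t)}\int_{(s,t)}\frac{(\tau-s)^{\alpha_2-1}(t-\tau)^{\alpha_1-1}\,d\tau}{(1+|\tau|)^{\alpha_1+\alpha_2}}\frac{|\mu_1|(ds)\,|\mu_2|(dt)}{(t-s)^{\alpha_1+\alpha_2-1}}\in[0,\infty].$$ *)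

theory Defs
  imports "HOL-Analysis.Analysis"
begin

text \<open>A complex Radon measure mu on the real line is represented through its polar
decomposition mu(dt) = h(t) nu(dt): nu = |mu| is a locally finite positive Borel measure
(the total variation) and h is a Borel function with |h| = 1.  Its value on a bounded
Borel set A is the integral of h over A w.r.t. nu.\<close>

definition cradon :: "real measure \<Rightarrow> (real \<Rightarrow> complex) \<Rightarrow> bool" where
  "cradon \<nu> h \<longleftrightarrow> sets \<nu> = sets borel \<and> h \<in> borel_measurable borel \<and>
     (\<forall>x. norm (h x) = 1) \<and> (\<forall>K. compact K \<longrightarrow> emeasure \<nu> K < \<infinity>)"

definition cmeas :: "real measure \<Rightarrow> (real \<Rightarrow> complex) \<Rightarrow> real set \<Rightarrow> complex" where
  "cmeas \<nu> h A = (LINT x:A|\<nu>. h x)"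

definition M_alpha :: "real \<Rightarrow> real measure \<Rightarrow> (real \<Rightarrow> complex) \<Rightarrow> bool" where
  "M_alpha \<alpha> \<nu> h \<longleftrightarrow> cradon \<nu> h \<and>
     (\<integral>\<^sup>+ t. ennreal ((1 + \<bar>t\<bar>) powr (- \<alpha>)) \<partial>\<nu>) < \<infinity>"

definition cauchy_tr :: "real \<Rightarrow> real measure \<Rightarrow> (real \<Rightarrow> complex) \<Rightarrow> complex \<Rightarrow> complex" where
  "cauchy_tr \<alpha> \<nu> h z = (\<integral> t. h t / (z + complex_of_real t) powr complex_of_real \<alpha> \<partial>\<nu>)"

text \<open>The quantity J_{alpha1,alpha2}[mu1,mu2]; it only depends on |mu1| = nu1, |mu2| = nu2.\<close>
definition Jfun :: "real \<Rightarrow> real \<Rightarrow> real measure \<Rightarrow> real measure \<Rightarrow> ennreal" where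
  "Jfun \<alpha>\<^sub>1 \<alpha>\<^sub>2 \<nu>\<^sub>1 \<nu>\<^sub>2 =
     (\<integral>\<^sup>+ t. (\<integral>\<^sup>+ s. indicator {..<t} s *
        (\<integral>\<^sup>+ \<tau>. indicator {s<..<t} \<tau> *
            ennreal ((\<tau> - s) powr (\<alpha>\<^sub>2 - 1) * (t - \<tau>) powr (\<alpha>\<^sub>1 - 1)
                     / (1 + \<bar>\<tau>\<bar>) powr (\<alpha>\<^sub>1 + \<alpha>\<^sub>2)) \<partial>lborel) *
        ennreal (1 / (t - s) powr (\<alpha>\<^sub>1 + \<alpha>\<^sub>2 - 1)) \<partial>\<nu>\<^sub>1) \<partial>\<nu>\<^sub>2)"

definition dbl :: "real \<Rightarrow> real \<Rightarrow> real measure \<Rightarrow> (real \<Rightarrow> complex) \<Rightarrow>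
    real measure \<Rightarrow> (real \<Rightarrow> complex) \<Rightarrow> real \<Rightarrow> complex" where
  "dbl a b \<nu> h \<nu>' h' \<tau> =
     (LINT t:{\<tau><..}|\<nu>'.
        (LINT s:{..<\<tau>}|\<nu>.
           complex_of_real ((\<tau> - s) powr (b - 1) * (t - \<tau>) powr (a - 1)
                            / (t - s) powr (a + b - 1)) * h s) * h' t)"

end

(*
  For s < t and z in the upper half-plane, the Feynman parametrisation gives
    B(a,b) (z+s)^(-a) (z+t)^(-b)
      = integral over tau in (s,t) of (tau-s)^(b-1) (t-tau)^(a-1) (t-s)^(1-a-b) (z+tau)^(-a-b).
  Writing the product of the two Cauchy transforms as a double integral, the parts s < t and s > t
  become, by this identity and Fubini (justified by the finiteness of the two J's), the Cauchy
  transforms of the two densities in u, while the diagonal s = t gives the atomic part.  The set of atoms of mu_1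
  is Lebesgue null, so the two parts of mu are mutually singular and |mu| is the sum of their
  total variations.
*)
theory Submission
  imports Defs
begin

section \<open>A beta integral over a segment in the upper half-plane\<close>

text \<open>For fixed z the modulus of (z+\<tau>)^(-a-b) is at most a constant times the weight
  (1+|\<tau>|)^(-a-b) in \<open>Jfun\<close>. This is why finiteness of J amounts to absolute
  convergence of the triple integral to be interchanged, with one majorant for all z up to a
  constant. Two obstacles shape the rest. The bases z+s and z+t are complex, so the parametrisation
  formula is more than a change of variable in the real beta integral; a deformation is used in
  which the weight, singular at the ends of the interval, stays fixed and is only integrated. The
  other obstacle is that \<mu> has to be delivered in polar form, with a phase of modulus 1 at every
  point. A formula for \<mu> alone does not give this: a single phase must serve the density and the
  atomic part at once. With it, everything about \<mu> follows from one identity for integrals of a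
  test function \<phi>: indicators of bounded sets give the values of \<mu>, and the kernel
  (z+\<tau>)^(-a-b) gives its Cauchy transform.\<close>

lemma has_bochner_integral_Beta:
  assumes "a > 0" "b > (0::real)"
  shows "has_bochner_integral lborel
    (\<lambda>x. indicator {0..1} x * (x powr (a - 1) * (1 - x) powr (b - 1))) (Beta a b)"
proof (rule has_bochner_integral_nn_integral)
  show "0 \<le> Beta a b"
    using has_integral_nonneg[OF has_integral_Beta_real[OF assms]] by simp
  \<comment> \<open>Extended by zero to the whole line, the nonnegative integrand has a gauge
    integral that is also its Lebesgue integral.\<close>
  have *: "((\<lambda>x. indicator {0..1} x * (x powr (a - 1) * (1 - x) powr (b - 1))) has_integral Beta a b) UNIV"
    using has_integral_Beta_real[OF assms]
    unfolding has_integral_restrict_UNIV[of "{0..1}" "\<lambda>x. x powr (a - 1) * (1 - x) powr (b - 1)", symmetric]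
    by (rule has_integral_eq[rotated]) (auto simp: indicator_def)
  show "(\<integral>\<^sup>+ x. ennreal (indicator {0..1} x * (x powr (a - 1) * (1 - x) powr (b - 1))) \<partial>lborel) = ennreal (Beta a b)"
    by (rule nn_integral_has_integral_lborel[OF _ _ *]) auto
qed auto

text \<open>The weight may blow up at the ends of the interval, but \<open>q\<close> is bounded on
  the compact square, so a multiple of the weight is a majorant. This licenses exchanging the
  integral over x with the one over the homotopy parameter.\<close>

lemma integrable_pair_bounded:
  fixes w :: "real \<Rightarrow> real" and q :: "real \<times> real \<Rightarrow> complex"
  assumes w: "integrable lborel w" and q: "continuous_on ({0..1} \<times> {0..1}) q"
  shows "integrable (lborel \<Otimes>\<^sub>M lborel)
    (\<lambda>(x,y). w x *\<^sub>R (indicator ({0..1} \<times> {0..1}) (x,y) *\<^sub>R q (x,y)))"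
proof -
  have "compact (q ` ({0..1} \<times> {0..1}))"
    by (intro compact_continuous_image q compact_Times compact_Icc)
  then obtain C where C: "\<And>p. p \<in> {0..1} \<times> {0..1} \<Longrightarrow> norm (q p) \<le> C" and "C > 0"
    by (metis bounded_pos compact_imp_bounded imageI)
  have [measurable]: "w \<in> borel_measurable borel" using w by auto
  define g where "g \<equiv> \<lambda>p. indicator ({0..1} \<times> {0..1}) p *\<^sub>R q p"
  have [measurable]: "g \<in> borel_measurable (borel \<Otimes>\<^sub>M borel)"
    unfolding borel_prod g_def
    by (intro borel_measurable_continuous_on_indicator q) (auto intro!: borel_closed closed_Times)
  have g: "norm (w x *\<^sub>R g (x,y)) \<le> C * norm (w x) * indicator {0..1} y" for x y
    using C[of "(x,y)"] \<open>C > 0\<close>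
    by (auto simp: g_def indicator_def mult.commute[of C] intro!: mult_left_mono)
  have "integrable (lborel \<Otimes>\<^sub>M lborel) (\<lambda>(x,y). w x *\<^sub>R g (x,y))"
  proof (rule integrableI_bounded)
    have "(\<integral>\<^sup>+ p. norm (case p of (x,y) \<Rightarrow> w x *\<^sub>R g (x,y)) \<partial>(lborel \<Otimes>\<^sub>M lborel))
      = (\<integral>\<^sup>+ x. (\<integral>\<^sup>+ y. norm (w x *\<^sub>R g (x,y)) \<partial>lborel) \<partial>lborel)"
      by (subst lborel.nn_integral_fst[symmetric]) auto
    also have "\<dots> \<le> (\<integral>\<^sup>+ x. (\<integral>\<^sup>+ y. ennreal (C * norm (w x)) * indicator {0..1::real} y \<partial>lborel) \<partial>lborel)"
      by (intro nn_integral_mono order_trans[OF ennreal_leI[OF g]]) (auto simp: indicator_def)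
    also have "\<dots> = ennreal C * (\<integral>\<^sup>+ x. ennreal (norm (w x)) \<partial>lborel)"
      using \<open>C > 0\<close> by (simp add: nn_integral_cmult ennreal_mult)
    also have "\<dots> < \<infinity>"
      using w by (auto simp: integrable_iff_bounded ennreal_mult_less_top)
    finally show "(\<integral>\<^sup>+ p. norm (case p of (x,y) \<Rightarrow> w x *\<^sub>R g (x,y)) \<partial>(lborel \<Otimes>\<^sub>M lborel)) < \<infinity>" .
  qed measurable
  then show ?thesis unfolding g_def .
qed

lemma integrable_weight_continuous:
  fixes w :: "real \<Rightarrow> real" and q :: "real \<Rightarrow> complex"
  assumes w: "integrable lborel w" and q: "continuous_on {0..1} q"
  shows "integrable lborel (\<lambda>x. w x *\<^sub>R (indicator {0..1} x *\<^sub>R q x))"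
proof -
  have "compact (q ` {0..1})"
    by (intro compact_continuous_image q compact_Icc)
  then obtain C where C: "\<And>p. p \<in> {0..1} \<Longrightarrow> norm (q p) \<le> C" and "C > 0"
    by (metis bounded_pos compact_imp_bounded imageI)
  have [measurable]: "w \<in> borel_measurable borel" using w by auto
  have [measurable]: "(\<lambda>p. indicator {0..1} p *\<^sub>R q p) \<in> borel_measurable borel"
    by (intro borel_measurable_continuous_on_indicator q) auto
  show ?thesis
  proof (rule Bochner_Integration.integrable_bound[OF integrable_mult_right[OF w, of C]])
    have "norm (w x *\<^sub>R (indicator {0..1} x *\<^sub>R q x)) \<le> norm (C * w x)" for x
      using C[of x] \<open>C > 0\<close>
      by (auto simp: indicator_def abs_mult mult.commute[of C] intro!: mult_left_mono)
    then show "AE x in lborel. norm (w x *\<^sub>R (indicator {0..1} x *\<^sub>R q x)) \<le> norm (C * w x)"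
      by simp
  qed measurable
qed

lemma Im_pos_not_nonpos_Reals: "Im z > 0 \<Longrightarrow> z \<notin> \<real>\<^sub>\<le>\<^sub>0"
  by (auto simp: complex_nonpos_Reals_iff)

lemma continuous_on_powr_upper_half_plane:
  fixes f :: "'a::topological_space \<Rightarrow> complex"
  assumes "continuous_on S f" "\<And>x. x \<in> S \<Longrightarrow> Im (f x) > 0"
  shows "continuous_on S (\<lambda>x. f x powr c)"
  using assms
  by (intro continuous_on_powr_complex continuous_intros)
     (force simp: complex_nonpos_Reals_iff)+

lemma Im_segment_pos:
  assumes "Im A > 0" "Im B > 0" "0 \<le> p" "p \<le> 1"
  shows "Im (B + of_real p * (A - B)) > 0"
proof -
  have "Im (B + of_real p * (A - B)) = (1 - p) * Im B + p * Im A"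
    by (simp add: algebra_simps)
  also have "\<dots> > 0"
    using assms by (cases "p = 0") (auto intro!: add_nonneg_pos)
  finally show ?thesis .
qed

text \<open>With \<open>D = B + x * h * c\<close> and \<open>h\<close> the homotopy parameter, the two algebraic identities below say that
  \<open>c * A\<^sub>h powr (a - 1)\<close> times the \<open>x\<close>-derivative of \<open>x\<^sup>a (1 - x)\<^sup>b D powr (- a - b)\<close> equals the
  \<open>h\<close>-derivative of the integrand \<open>A\<^sub>h powr a * x powr (a - 1) (1 - x) powr (b - 1) D powr (- a - b)\<close>,
  where \<open>A\<^sub>h = B + h * c\<close>.\<close>

lemma beta_total_derivative:
  fixes c :: complex
  shows "p * x * (v * (1 - x)) * ((- a - b) * (d * (h * c)))
      + (a * p * (v * (1 - x)) - p * x * (b * v)) * (d * (B + x * h * c))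
    = p * v * (d * (a * (1 - x) * B - b * x * (B + h * c)))"
  by (simp add: algebra_simps)

lemma homotopy_derivative:
  fixes c :: complex
  shows "a * (e * c) * (d * (B + x * h * c)) + (- (a + b) * (d * (x * c))) * (e * (B + h * c))
    = e * c * (d * (a * (1 - x) * B - b * x * (B + h * c)))"
  by (simp add: algebra_simps)

text \<open>The integrand is a derivative in x, and its primitive vanishes at both ends because
  \<open>a\<close> and \<open>b\<close> are positive. Up to a factor independent of x, it is also
  the homotopy derivative of the integrand of the beta integral.\<close>

lemma feynman_derivative_integral:
  fixes A B :: complex and a b \<theta> :: real
  assumes ab: "a > 0" "b > 0" and AB: "Im A > 0" "Im B > 0" and th: "0 \<le> \<theta>" "\<theta> \<le> 1"
  defines "D \<equiv> \<lambda>x::real. B + of_real (x * \<theta>) * (A - B)"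
  defines "w \<equiv> \<lambda>x::real. indicator {0..1} x * (x powr (a - 1) * (1 - x) powr (b - 1))"
  shows "(\<integral>x. w x *\<^sub>R (indicator {0..1} x *\<^sub>R (D x powr (of_real (- a - b - 1)) *
     (of_real (a * (1 - x)) * B - of_real (b * x) * (B + of_real \<theta> * (A - B))))) \<partial>lborel) = 0"
    (is "integral\<^sup>L lborel ?F = 0")
proof -
  have ImD: "Im (D x) > 0" if "x \<in> {0..1}" for x
    unfolding D_def using th that by (intro Im_segment_pos AB) (auto intro: mult_le_one)
  have contD: "continuous_on {0..1} D" unfolding D_def by (intro continuous_intros)
  have cD: "continuous_on {0..1} (\<lambda>x. D x powr of_real r)" for r
    by (intro continuous_on_powr_upper_half_plane contD ImD)
  have w: "integrable lborel w"
    using has_bochner_integral_Beta[OF ab] unfolding w_def by (simp add: has_bochner_integral_iff)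
  have intF: "integrable lborel ?F"
    by (intro integrable_weight_continuous w continuous_intros cD)
  define f where "f \<equiv> \<lambda>x. of_real (x powr a * (1 - x) powr b) * D x powr (of_real (- a - b))"
  have der: "(f has_vector_derivative ?F x) (at x)" if x: "x \<in> {0<..<1}" for x
  proof -
    have "((\<lambda>x. x powr a * (1 - x) powr b) has_real_derivative
       (a * x powr (a - 1) * (1 - x) powr b - x powr a * (b * (1 - x) powr (b - 1)))) (at x)"
      using x by (auto intro!: derivative_eq_intros simp: powr_diff field_simps)
    then have d1: "((\<lambda>x. complex_of_real (x powr a * (1 - x) powr b)) has_vector_derivative
       of_real (a * x powr (a - 1) * (1 - x) powr b - x powr a * (b * (1 - x) powr (b - 1)))) (at x)"
      by (intro has_vector_derivative_of_real) (simp add: has_real_derivative_iff_has_vector_derivative)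
    have np: "B + of_real (x * \<theta>) * (A - B) \<notin> \<real>\<^sub>\<le>\<^sub>0"
      using ImD[of x] x Im_pos_not_nonpos_Reals unfolding D_def by auto
    \<comment> \<open>The derivative is taken in a complex variable y and then restricted to the
      real axis.\<close>
    have "((\<lambda>y. (B + y * of_real \<theta> * (A - B)) powr (of_real (- a - b))) has_field_derivative
        of_real (- a - b) * (D x powr (of_real (- a - b - 1)) * (of_real \<theta> * (A - B)))) (at (of_real x))"
      using np by (auto intro!: derivative_eq_intros simp: D_def)
    from has_vector_derivative_real_field[OF this]
    have d2: "((\<lambda>x. D x powr (of_real (- a - b))) has_vector_derivative
        of_real (- a - b) * (D x powr (of_real (- a - b - 1)) * (of_real \<theta> * (A - B)))) (at x)"
      by (simp add: D_def)
    have D': "B + of_real x * of_real \<theta> * (A - B) = D x" by (simp add: D_def)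
    have nz: "D x \<noteq> 0" using ImD[of x] x by auto
    have e1: "D x powr (of_real (- a - b)) = D x powr (of_real (- a - b - 1)) * D x"
      using nz powr_add[of "D x" "of_real (- a - b - 1)" 1] by (simp add: add.commute diff_add_eq)
    have e2: "x powr a = x powr (a - 1) * x" "(1 - x) powr b = (1 - x) powr (b - 1) * (1 - x)"
      using x by (simp_all add: powr_diff)
    show ?thesis
      unfolding f_def
    proof (rule has_vector_derivative_eq_rhs[OF has_vector_derivative_mult[OF d1 d2]])
      have "indicator {0..1} x = (1::real)" using x by auto
      then show "complex_of_real (x powr a * (1 - x) powr b) *
        (of_real (- a - b) * (D x powr (of_real (- a - b - 1)) * (of_real \<theta> * (A - B)))) +
        of_real (a * x powr (a - 1) * (1 - x) powr b - x powr a * (b * (1 - x) powr (b - 1))) *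
        D x powr of_real (- a - b) = ?F x"
        unfolding e1 e2 w_def scaleR_conv_of_real
        using beta_total_derivative[where p = "of_real (x powr (a - 1))" and x = "of_real x"
            and v = "of_real ((1 - x) powr (b - 1))" and a = "of_real a" and b = "of_real b"
            and d = "D x powr (of_real (- a - b - 1))" and h = "of_real \<theta>" and c = "A - B" and B = B]
        by (simp only: D' of_real_mult of_real_diff of_real_minus of_real_1 mult_1_left)
    qed
  qed
  \<comment> \<open>An exponent below 1 makes \<open>f\<close> non-differentiable at an end of the
    interval, so only continuity is used there.\<close>
  have "(?F has_integral (f 1 - f 0)) {0..1}"
  proof (rule fundamental_theorem_of_calculus_interior[OF _ _ der])
    show "continuous_on {0..1} f" unfolding f_def
      by (intro continuous_intros cD continuous_on_powr') (use ab in auto)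
  qed auto
  then have "(?F has_integral 0) {0..1}" using ab by (simp add: f_def)
  then have "((\<lambda>x. if x \<in> {0..1} then ?F x else 0) has_integral 0) UNIV"
    unfolding has_integral_restrict_UNIV .
  also have "(\<lambda>x. if x \<in> {0..1} then ?F x else 0) = ?F" by (auto simp: indicator_def w_def)
  finally show ?thesis
    using has_integral_integral_lborel[OF intF] has_integral_unique by blast
qed

text \<open>Moving \<open>A\<close> along the segment to \<open>B\<close> stays in the upper half-plane, which avoids analytic
  continuation and any discussion of branches; at the endpoint \<open>B\<close> the integral is the real beta integral.\<close>

lemma feynman_unit_interval:
  fixes A B :: complex and a b :: real
  assumes ab: "a > 0" "b > 0" and AB: "Im A > 0" "Im B > 0"
  shows "(\<integral>x. (indicator {0..1} x * (x powr (a - 1) * (1 - x) powr (b - 1))) *\<^sub>R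
       (B + of_real x * (A - B)) powr (- of_real (a + b)) \<partial>lborel)
     = of_real (Beta a b) * (A powr (- of_real a) * B powr (- of_real b))"
proof -
  define E where "E \<equiv> \<lambda>p::real. B + of_real p * (A - B)"
  define w where "w \<equiv> \<lambda>x::real. indicator {0..1} x * (x powr (a - 1) * (1 - x) powr (b - 1))"
  have contE: "continuous_on UNIV E"
    unfolding E_def by (intro continuous_intros)
  have ImE: "Im (E x) > 0" if "x \<in> {0..1}" for x
    unfolding E_def using that by (intro Im_segment_pos AB) auto
  have xt: "x * \<theta> \<in> {0..1}" if "x \<in> {0..1}" "\<theta> \<in> {0..1}" for x \<theta> :: real
    using that by (auto intro: mult_le_one)
  have w: "integrable lborel w" and wB: "integral\<^sup>L lborel w = Beta a b"
    using has_bochner_integral_Beta[OF ab] unfolding w_def by (simp_all add: has_bochner_integral_iff)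
  \<comment> \<open>This is the \<theta>-derivative of the integrand with the singular weight
    \<open>w\<close> split off, which leaves a function continuous on the closed square.\<close>
  define q where "q \<equiv> \<lambda>(x::real, \<theta>::real). E \<theta> powr (of_real (a - 1)) * (A - B) *
     (E (x * \<theta>) powr (of_real (- a - b - 1)) * (of_real (a * (1 - x)) * B - of_real (b * x) * E \<theta>))"
  have contq: "continuous_on ({0..1} \<times> {0..1}) q"
  proof -
    have "continuous_on ({0..1} \<times> {0..1}) (\<lambda>p::real \<times> real. E (snd p) powr of_real (a - 1))"
      by (rule continuous_on_powr_upper_half_plane)
         (use ImE in \<open>auto intro!: continuous_on_compose2[OF contE] continuous_intros\<close>)
    moreover have "continuous_on ({0..1} \<times> {0..1}) (\<lambda>p::real \<times> real. E (fst p * snd p) powr of_real (- a - b - 1))"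
      by (rule continuous_on_powr_upper_half_plane)
         (use ImE[OF xt] in \<open>auto intro!: continuous_on_compose2[OF contE] continuous_intros\<close>)
    moreover have "continuous_on ({0..1} \<times> {0..1}) (\<lambda>p::real \<times> real. E (snd p))"
      by (auto intro!: continuous_on_compose2[OF contE] continuous_intros)
    ultimately show ?thesis
      unfolding q_def case_prod_beta
      by (intro continuous_on_mult continuous_on_diff continuous_on_of_real continuous_on_const
        continuous_on_fst continuous_on_snd continuous_on_id)
  qed
  define F where "F \<equiv> \<lambda>x \<theta>. w x *\<^sub>R (indicator ({0..1} \<times> {0..1}) (x,\<theta>) *\<^sub>R q (x,\<theta>))"
  have int: "integrable (lborel \<Otimes>\<^sub>M lborel) (case_prod F)"
    using integrable_pair_bounded[OF w contq] unfolding F_def .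
  \<comment> \<open>The factor \<open>E \<theta> powr (of_real a)\<close> is there to make the
    integral of \<open>w x *\<^sub>R p x \<theta>\<close> over x constant in \<theta>. At \<theta> =
    1 this integral is A^a times the wanted one; at \<theta> = 0 it is the beta value times
    B^(-b).\<close>
  define p where "p \<equiv> \<lambda>x \<theta>. E \<theta> powr (of_real a) * E (x * \<theta>) powr (- of_real (a + b))"
  have Dp: "(p x has_vector_derivative q (x, \<theta>)) (at \<theta> within {0..1})" if "x \<in> {0..1}" "\<theta> \<in> {0..1}" for x \<theta>
  proof -
    have np: "B + of_real \<theta> * (A - B) \<notin> \<real>\<^sub>\<le>\<^sub>0" "B + of_real (x * \<theta>) * (A - B) \<notin> \<real>\<^sub>\<le>\<^sub>0"
      using ImE[OF that(2)] ImE[OF xt[OF that]] Im_pos_not_nonpos_Reals unfolding E_def by auto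
    then have nz: "E \<theta> \<noteq> 0" "E (x * \<theta>) \<noteq> 0" by (auto simp: E_def)
    have "((\<lambda>y. (B + y * (A - B)) powr (of_real a) * (B + of_real x * y * (A - B)) powr (- of_real (a + b)))
       has_field_derivative
         (of_real a * (E \<theta> powr (of_real (a - 1)) * (A - B))) * E (x * \<theta>) powr (- of_real (a + b))
         + (- of_real (a + b) * (E (x * \<theta>) powr (- of_real (a + b) - 1) * (of_real x * (A - B)))) * E \<theta> powr (of_real a))
        (at (of_real \<theta>))"
      using np by (auto intro!: derivative_eq_intros simp: E_def)
    from has_vector_derivative_real_field[OF this]
    have "(p x has_vector_derivative
         (of_real a * (E \<theta> powr (of_real (a - 1)) * (A - B))) * E (x * \<theta>) powr (- of_real (a + b))
         + (- of_real (a + b) * (E (x * \<theta>) powr (- of_real (a + b) - 1) * (of_real x * (A - B)))) * E \<theta> powr (of_real a))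
        (at \<theta> within {0..1})"
      unfolding p_def by (simp add: E_def)
    moreover have "E \<theta> powr (of_real a) = E \<theta> powr (of_real (a - 1)) * E \<theta>"
      using nz powr_add[of "E \<theta>" "of_real (a - 1)" 1] by (simp)
    moreover have "E (x * \<theta>) powr (- of_real (a + b)) = E (x * \<theta>) powr (of_real (- a - b - 1)) * E (x * \<theta>)"
      using nz powr_add[of "E (x * \<theta>)" "of_real (- a - b - 1)" 1] by (simp add: add.commute diff_add_eq)
    moreover have "- complex_of_real (a + b) - 1 = of_real (- a - b - 1)" by simp
    moreover note homotopy_derivative[of "of_real a" "E \<theta> powr (of_real (a - 1))" "A - B"
        "E (x * \<theta>) powr (of_real (- a - b - 1))" B "of_real x" "of_real \<theta>" "of_real b"]
    moreover have "E (x * \<theta>) = B + of_real x * of_real \<theta> * (A - B)" "E \<theta> = B + of_real \<theta> * (A - B)"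
      by (simp_all add: E_def)
    moreover have "complex_of_real (a + b) = of_real a + of_real b" by simp
    ultimately have "(p x has_vector_derivative
       E \<theta> powr (of_real (a - 1)) * (A - B) * (E (x * \<theta>) powr (of_real (- a - b - 1)) *
        (of_real a * (1 - of_real x) * B - of_real b * of_real x * E \<theta>))) (at \<theta> within {0..1})"
      by (metis (no_types, lifting))
    then show ?thesis
      unfolding q_def by simp
  qed
  have inner: "(\<integral>\<theta>. F x \<theta> \<partial>lborel) = w x *\<^sub>R (p x 1 - p x 0)" for x
  proof (cases "x \<in> {0..1}")
    case True
    have "continuous_on {0..1} (\<lambda>\<theta>. q (x, \<theta>))"
      using True by (intro continuous_on_compose2[OF contq] continuous_intros) auto
    then have "(\<integral>\<theta>. indicator {0..1} \<theta> *\<^sub>R q (x, \<theta>) \<partial>lborel) = p x 1 - p x 0"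
      using Dp[OF True] by (intro integral_FTC_atLeastAtMost) auto
    moreover have "indicator ({0..1} \<times> {0..1}) (x, \<theta>) = (indicator {0..1} \<theta> :: real)" for \<theta> :: real
      using True by (auto simp: indicator_def)
    ultimately show ?thesis by (simp add: F_def del: scaleR_scaleR)
  qed (auto simp: F_def w_def)
  have outer: "(\<integral>x. F x \<theta> \<partial>lborel) = 0" for \<theta>
  proof (cases "\<theta> \<in> {0..1}")
    case True
    have "(\<integral>x. F x \<theta> \<partial>lborel) = (\<integral>x. (E \<theta> powr (of_real (a - 1)) * (A - B)) * (w x *\<^sub>R (indicator {0..1} x *\<^sub>R (E (x * \<theta>) powr (of_real (- a - b - 1)) *
     (of_real (a * (1 - x)) * B - of_real (b * x) * (B + of_real \<theta> * (A - B)))))) \<partial>lborel)"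
      unfolding F_def q_def using True by (intro Bochner_Integration.integral_cong) (auto simp: indicator_def E_def)
    also have "\<dots> = 0"
      unfolding integral_mult_right_zero
      using feynman_derivative_integral[OF ab AB, of \<theta>] True unfolding E_def w_def by simp
    finally show ?thesis .
  qed (auto simp: F_def)
  \<comment> \<open>Constancy in \<theta> is read off from one double integral: integrating over
    \<theta> first gives the difference of the two end values, integrating over x first gives zero.
    This replaces differentiation under the integral sign.\<close>
  have "(\<integral>x. (\<integral>\<theta>. F x \<theta> \<partial>lborel) \<partial>lborel) = (\<integral>\<theta>. (\<integral>x. F x \<theta> \<partial>lborel) \<partial>lborel)"
    by (rule lborel_pair.Fubini_integral[symmetric, OF int])
  then have "(\<integral>x. w x *\<^sub>R (p x 1 - p x 0) \<partial>lborel) = 0"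
    unfolding inner outer by simp
  moreover have pe: "w x *\<^sub>R (p x 1 - p x 0) =
     A powr of_real a * (w x *\<^sub>R (indicator {0..1} x *\<^sub>R E x powr (- of_real (a + b)))) - w x *\<^sub>R B powr (- of_real b)" for x
  proof -
    have "B \<noteq> 0" using AB by auto
    then have "B powr of_real a * B powr (- of_real (a + b)) = B powr (- of_real b)"
      by (simp add: powr_add[symmetric])
    then show ?thesis
      by (auto simp: p_def E_def w_def indicator_def algebra_simps)
  qed
  moreover have "integrable lborel (\<lambda>x. w x *\<^sub>R (indicator {0..1} x *\<^sub>R E x powr (- of_real (a + b))))"
    using ImE by (intro integrable_weight_continuous w continuous_on_powr_upper_half_plane continuous_on_subset[OF contE]) auto
  ultimately have "A powr of_real a * (\<integral>x. w x *\<^sub>R (indicator {0..1} x *\<^sub>R E x powr (- of_real (a + b))) \<partial>lborel) = of_real (Beta a b) * B powr (- of_real b)"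
    using w wB by (simp add: integral_scaleR_left scaleR_conv_of_real)
  moreover have "(\<lambda>x. w x *\<^sub>R (indicator {0..1} x *\<^sub>R E x powr (- of_real (a + b)))) = (\<lambda>x. w x *\<^sub>R E x powr (- of_real (a + b)))"
    by (auto simp: w_def indicator_def)
  moreover have "A powr of_real a \<noteq> 0" "A powr (- of_real a) = inverse (A powr of_real a)"
    using AB by (auto simp: powr_minus)
  moreover have solve_for: "I = Q * X" if "P * I = X" "P \<noteq> 0" "Q = inverse P" for P Q I X :: complex
    using that by (auto simp: mult.assoc[symmetric])
  ultimately have "(\<integral>x. w x *\<^sub>R E x powr (- of_real (a + b)) \<partial>lborel)
      = A powr (- of_real a) * (of_real (Beta a b) * B powr (- of_real b))"
    by (metis (no_types, lifting) solve_for)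
  then show ?thesis
    unfolding w_def E_def by (simp only: mult.left_commute)
qed


section \<open>The beta kernel\<close>

text \<open>In \<tau> this is \<open>Beta a b\<close> times the density of a beta distribution
  rescaled to the interval from s to t. Being zero unless s < \<tau> < t, it absorbs the domains of
  integration of \<open>Jfun\<close> and \<open>dbl\<close>, so that both become integrals over full
  lines.\<close>

definition beta_kernel :: "real \<Rightarrow> real \<Rightarrow> real \<Rightarrow> real \<Rightarrow> real \<Rightarrow> real" where
  "beta_kernel a b s t \<tau> = (if s < \<tau> \<and> \<tau> < t
     then (\<tau> - s) powr (b - 1) * (t - \<tau>) powr (a - 1) / (t - s) powr (a + b - 1) else 0)"

lemma beta_kernel_nonneg: "beta_kernel a b s t \<tau> \<ge> 0"
  by (simp add: beta_kernel_def)

text \<open>The substitution reverses orientation: x = 0 corresponds to t and x = 1 to s. With B = z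
  + t and A = z + s, the point B + x (A - B) of the unit interval formula is then z +
  \<tau>.\<close>

lemma beta_kernel_affine:
  assumes "s < t"
  shows "(t - s) * beta_kernel a b s t (t - (t - s) * x) = indicator {0..1} x * (x powr (a - 1) * (1 - x) powr (b - 1))"
proof (cases "0 < x \<and> x < 1")
  case True
  define d where "d = t - s"
  have d: "d > 0" using assms by (simp add: d_def)
  have "t - d * x - s = (1 - x) * d" by (simp add: d_def algebra_simps)
  moreover have "s < t - d * x"
    using calculation True d by (metis diff_gt_0_iff_gt mult_pos_pos)
  ultimately have "d * beta_kernel a b s t (t - d * x) =
      d * (((1 - x) * d) powr (b - 1) * (x * d) powr (a - 1) / d powr (a + b - 1))"
    using True d by (simp add: beta_kernel_def d_def[symmetric] mult.commute)
  \<comment> \<open>The Jacobian, written as \<open>d powr 1\<close>, supplies the power that lets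
    all powers of d cancel.\<close>
  also have "\<dots> = (x powr (a - 1) * (1 - x) powr (b - 1)) * (d powr 1 * d powr (b - 1) * d powr (a - 1) / d powr (a + b - 1))"
    using True d by (simp add: powr_mult)
  also have "d powr 1 * d powr (b - 1) * d powr (a - 1) = d powr (a + b - 1)"
    unfolding powr_add[symmetric] by (simp add: algebra_simps)
  finally show ?thesis using True d unfolding d_def by simp
next
  case False
  have "t - (t - s) * x \<le> s" if "x \<ge> 1"
  proof -
    have "(t - s) * 1 \<le> (t - s) * x" using that assms by (intro mult_left_mono) auto
    then show ?thesis by (simp add: algebra_simps)
  qed
  with False have "\<not> (s < t - (t - s) * x \<and> t - (t - s) * x < t)"
    using assms by (auto simp: zero_less_mult_iff)
  \<comment> \<open>At the two ends the right-hand side vanishes because 0 \<open>powr\<close> any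
    exponent is 0, so the identity is pointwise and not just almost everywhere.\<close>
  moreover have "x \<in> {0..1} \<Longrightarrow> x = 0 \<or> x = 1" using False by auto
  ultimately show ?thesis by (auto simp: beta_kernel_def indicator_def)
qed

lemma feynman_kernel:
  assumes ab: "a > 0" "b > 0" and z: "Im z > 0" and st: "s < t"
  shows "(\<integral>\<tau>. beta_kernel a b s t \<tau> *\<^sub>R (z + of_real \<tau>) powr (- of_real (a + b)) \<partial>lborel)
    = of_real (Beta a b) * ((z + of_real s) powr (- of_real a) * (z + of_real t) powr (- of_real b))"
proof -
  have eq: "t + (- (t - s)) * x = t - (t - s) * x" "\<bar>- (t - s)\<bar> = t - s" for x
    using st by (auto simp: algebra_simps)
  have "(\<integral>\<tau>. beta_kernel a b s t \<tau> *\<^sub>R (z + of_real \<tau>) powr (- of_real (a + b)) \<partial>lborel)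
    = \<bar>- (t - s)\<bar> *\<^sub>R (\<integral>x. beta_kernel a b s t (t + (- (t - s)) * x) *\<^sub>R (z + of_real (t + (- (t - s)) * x)) powr (- of_real (a + b)) \<partial>lborel)"
    using st by (intro lborel_integral_real_affine) auto
  also have "\<dots> = (\<integral>x. ((t - s) * beta_kernel a b s t (t - (t - s) * x)) *\<^sub>R (z + of_real (t - (t - s) * x)) powr (- of_real (a + b)) \<partial>lborel)"
    unfolding integral_scaleR_right[symmetric] eq by simp
  also have "\<dots> = (\<integral>x. (indicator {0..1} x * (x powr (a - 1) * (1 - x) powr (b - 1))) *\<^sub>R
       ((z + of_real t) + of_real x * ((z + of_real s) - (z + of_real t))) powr (- of_real (a + b)) \<partial>lborel)"
    unfolding beta_kernel_affine[OF st]
    by (intro Bochner_Integration.integral_cong refl) (simp add: algebra_simps)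
  also have "\<dots> = of_real (Beta a b) * ((z + of_real s) powr (- of_real a) * (z + of_real t) powr (- of_real b))"
    by (rule feynman_unit_interval[OF ab]) (use z in auto)
  finally show ?thesis .
qed

lemma measurable_beta_kernel [measurable]:
  "(\<lambda>x. beta_kernel a b (f x) (g x) (k x)) \<in> borel_measurable M"
  if [measurable]: "f \<in> borel_measurable M" "g \<in> borel_measurable M" "k \<in> borel_measurable M"
  unfolding beta_kernel_def by measurable

lemma Jfun_eq_beta_kernel:
  assumes [measurable_cong]: "sets M = sets borel" "sets N = sets borel"
  shows "Jfun a b M N = (\<integral>\<^sup>+ t. (\<integral>\<^sup>+ s. (\<integral>\<^sup>+ \<tau>.
     ennreal (beta_kernel a b s t \<tau> * (1 + \<bar>\<tau>\<bar>) powr (- (a + b))) \<partial>lborel) \<partial>M) \<partial>N)"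
  unfolding Jfun_def
proof (intro nn_integral_cong)
  fix s t :: real
  let ?f = "\<lambda>\<tau>. indicator {s<..<t} \<tau> * ennreal ((\<tau> - s) powr (b - 1) * (t - \<tau>) powr (a - 1) / (1 + \<bar>\<tau>\<bar>) powr (a + b))"
  show "indicator {..<t} s * (\<integral>\<^sup>+ \<tau>. ?f \<tau> \<partial>lborel) * ennreal (1 / (t - s) powr (a + b - 1))
    = (\<integral>\<^sup>+ \<tau>. ennreal (beta_kernel a b s t \<tau> * (1 + \<bar>\<tau>\<bar>) powr (- (a + b))) \<partial>lborel)"
  proof (cases "s < t")
    case True
    have "indicator {..<t} s * (\<integral>\<^sup>+ \<tau>. ?f \<tau> \<partial>lborel) * ennreal (1 / (t - s) powr (a + b - 1))
      = (\<integral>\<^sup>+ \<tau>. ?f \<tau> * ennreal (1 / (t - s) powr (a + b - 1)) \<partial>lborel)"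
      using True by (simp add: nn_integral_multc)
    also have "\<dots> = (\<integral>\<^sup>+ \<tau>. ennreal (beta_kernel a b s t \<tau> * (1 + \<bar>\<tau>\<bar>) powr (- (a + b))) \<partial>lborel)"
      unfolding powr_minus[of _ "a + b"]
      by (intro nn_integral_cong)
         (auto simp: beta_kernel_def indicator_def ennreal_mult[symmetric] divide_simps)
    finally show ?thesis .
  next
    case False
    then have "beta_kernel a b s t \<tau> = 0" for \<tau> by (auto simp: beta_kernel_def)
    then show ?thesis using False by simp
  qed
qed

text \<open>Scalar factors pass through a Bochner integral even where it takes its default value 0,
  so the two forms agree at every \<tau>.\<close>

lemma dbl_eq_beta_kernel:
  "dbl a b M f N g \<tau> = (\<integral>t. (\<integral>s. beta_kernel a b s t \<tau> *\<^sub>R (f s * g t) \<partial>M) \<partial>N)"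
proof -
  have "(indicator {\<tau><..} t *\<^sub>R ((\<integral>s. indicator {..<\<tau>} s *\<^sub>R (complex_of_real ((\<tau> - s) powr (b - 1) * (t - \<tau>) powr (a - 1)
                            / (t - s) powr (a + b - 1)) * f s) \<partial>M) * g t))
     = (\<integral>s. beta_kernel a b s t \<tau> *\<^sub>R (f s * g t) \<partial>M)" for t
    unfolding integral_mult_left_zero[symmetric] integral_scaleR_right[symmetric]
    by (intro Bochner_Integration.integral_cong refl)
       (auto simp: beta_kernel_def indicator_def scaleR_conv_of_real)
  then show ?thesis
    unfolding dbl_def set_lebesgue_integral_def by simp
qed

section \<open>Domination of the Cauchy kernel by the weight\<close>

lemma cmod_add_of_real_lower_bound:
  assumes z: "Im z > 0"
  obtains c where "c > 0" "\<And>t. c * (1 + \<bar>t\<bar>) \<le> cmod (z + of_real t)"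
proof
  \<comment> \<open>The constant comes from |t| \<le> |z+t| + |z| together with |z| + 1 \<le> |z+t|
    (|z| + 1) / Im z, the latter because |z+t| is at least Im z.\<close>
  define c where "c = 1 / (1 + (cmod z + 1) / Im z)"
  show "c > 0" unfolding c_def using z by (intro divide_pos_pos add_pos_nonneg divide_nonneg_pos) auto
  fix t
  have "Im z \<le> cmod (z + of_real t)"
    using abs_Im_le_cmod[of "z + of_real t"] by simp
  then have "cmod z + 1 \<le> cmod (z + of_real t) * ((cmod z + 1) / Im z)"
    using z by (simp add: field_simps) (metis add.commute add_mono_thms_linordered_semiring(1) distrib_left mult.commute mult_left_mono norm_ge_zero)
  moreover have "\<bar>t\<bar> \<le> cmod (z + of_real t) + cmod z"
    using norm_triangle_ineq4[of "z + of_real t" z] by simp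
  ultimately have "1 + \<bar>t\<bar> \<le> cmod (z + of_real t) * (1 + (cmod z + 1) / Im z)"
    by (simp add: algebra_simps)
  then show "c * (1 + \<bar>t\<bar>) \<le> cmod (z + of_real t)"
    unfolding c_def using z by (simp add: divide_simps add_pos_nonneg mult.commute)
qed

text \<open>For a real exponent the modulus of a complex power depends only on the modulus of the
  base, so the linear lower bound can be raised to a negative power.\<close>

lemma cmod_powr_neg_bound:
  assumes z: "Im z > 0" and r: "r \<ge> 0"
  obtains C where "C > 0" "\<And>t. cmod ((z + of_real t) powr (- of_real r)) \<le> C * (1 + \<bar>t\<bar>) powr (- r)"
proof -
  obtain c where c: "c > 0" "\<And>t. c * (1 + \<bar>t\<bar>) \<le> cmod (z + of_real t)"
    using cmod_add_of_real_lower_bound[OF z] by blast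
  show ?thesis
  proof
    show "c powr (- r) > 0" using c by simp
    fix t
    have "cmod ((z + of_real t) powr (- of_real r)) = cmod (z + of_real t) powr (- r)"
      using norm_powr_real_powr'[of "- of_real r" "z + of_real t"] by simp
    also have "\<dots> \<le> (c * (1 + \<bar>t\<bar>)) powr (- r)"
      by (rule powr_mono2') (use c r in auto)
    also have "\<dots> = c powr (- r) * (1 + \<bar>t\<bar>) powr (- r)"
      using c by (simp add: powr_mult)
    finally show "cmod ((z + of_real t) powr (- of_real r)) \<le> c powr (- r) * (1 + \<bar>t\<bar>) powr (- r)" .
  qed
qed

lemma borel_measurable_powr_upper_half_plane [measurable]:
  "Im z > 0 \<Longrightarrow> (\<lambda>t. (z + of_real t) powr c) \<in> borel_measurable borel"
  by (intro borel_measurable_continuous_onI continuous_on_powr_upper_half_plane continuous_intros) auto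


section \<open>Integration against the kernel on a triangle\<close>

text \<open>The triangle is the region s < t, with s integrated against \<open>M\<close> and t
  against \<open>N\<close>. The product is taken as N times M because t is the outer variable in
  \<open>Jfun\<close> and \<open>dbl\<close>. The region s > t is covered by a second instance with
  the two measures, phases and exponents exchanged.\<close>

locale triangle = pair_sigma_finite N M
  for M N :: "real measure" +
  fixes f g :: "real \<Rightarrow> complex" and a b :: real
  assumes a_pos: "a > 0" and b_pos: "b > 0"
    and sets_M [measurable_cong, simp]: "sets M = sets borel"
    and sets_N [measurable_cong, simp]: "sets N = sets borel"
    and f_borel [measurable]: "f \<in> borel_measurable borel"
    and g_borel [measurable]: "g \<in> borel_measurable borel"
    and norm_f: "\<And>x. cmod (f x) = 1" and norm_g: "\<And>x. cmod (g x) = 1"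
    and J_finite: "Jfun a b M N < \<infinity>"
begin

sublocale Q: pair_sigma_finite "N \<Otimes>\<^sub>M M" lborel ..

lemma dbl_borel [measurable]: "dbl a b M f N g \<in> borel_measurable borel"
  unfolding dbl_eq_beta_kernel[abs_def] by measurable

lemma Jfun_eq_product: "Jfun a b M N = (\<integral>\<^sup>+ (p, \<tau>). ennreal (beta_kernel a b (snd p) (fst p) \<tau> * (1 + \<bar>\<tau>\<bar>) powr (- (a + b))) \<partial>((N \<Otimes>\<^sub>M M) \<Otimes>\<^sub>M lborel))"
  by (simp add: Jfun_eq_beta_kernel lborel.nn_integral_fst[symmetric] M2.nn_integral_fst[symmetric])

context
  fixes \<phi> :: "real \<Rightarrow> complex" and C :: real
  assumes phi [measurable]: "\<phi> \<in> borel_measurable borel" and C: "C \<ge> 0"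
    and bound: "\<And>\<tau>. cmod (\<phi> \<tau>) \<le> C * (1 + \<bar>\<tau>\<bar>) powr (- (a + b))"
begin

text \<open>The test function \<phi> is left general because it is needed twice: as the weight
  itself, to place the density in the right space, and as the Cauchy kernel.\<close>

definition kernel_integrand where "kernel_integrand p \<tau> = beta_kernel a b (snd p) (fst p) \<tau> *\<^sub>R (f (snd p) * g (fst p) * \<phi> \<tau>)"

text \<open>The phases have modulus 1 and \<phi> is dominated by the weight, so the integral of the
  modulus is at most C times J.\<close>

lemma integrable_kernel_integrand: "integrable ((N \<Otimes>\<^sub>M M) \<Otimes>\<^sub>M lborel) (case_prod kernel_integrand)"
proof (rule integrableI_bounded)
  show "case_prod kernel_integrand \<in> borel_measurable ((N \<Otimes>\<^sub>M M) \<Otimes>\<^sub>M lborel)"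
    unfolding kernel_integrand_def by measurable
  have "(\<integral>\<^sup>+ x. ennreal (cmod (case_prod kernel_integrand x)) \<partial>((N \<Otimes>\<^sub>M M) \<Otimes>\<^sub>M lborel))
     \<le> (\<integral>\<^sup>+ (p, \<tau>). ennreal C * ennreal (beta_kernel a b (snd p) (fst p) \<tau> * (1 + \<bar>\<tau>\<bar>) powr (- (a + b))) \<partial>((N \<Otimes>\<^sub>M M) \<Otimes>\<^sub>M lborel))"
  proof (intro nn_integral_mono)
    fix x :: "(real \<times> real) \<times> real"
    obtain t s \<tau> where x: "x = ((t, s), \<tau>)" by (metis surj_pair)
    have "beta_kernel a b s t \<tau> * cmod (\<phi> \<tau>) \<le> beta_kernel a b s t \<tau> * (C * (1 + \<bar>\<tau>\<bar>) powr (- (a + b)))"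
      by (intro mult_left_mono bound beta_kernel_nonneg)
    then show "ennreal (cmod (case_prod kernel_integrand x)) \<le> (case x of (p, \<tau>) \<Rightarrow>
       ennreal C * ennreal (beta_kernel a b (snd p) (fst p) \<tau> * (1 + \<bar>\<tau>\<bar>) powr (- (a + b))))"
      using C by (simp add: x kernel_integrand_def norm_mult norm_f norm_g beta_kernel_nonneg ennreal_mult[symmetric] mult_ac)
  qed
  also have "\<dots> = ennreal C * Jfun a b M N"
    unfolding Jfun_eq_product case_prod_beta by (rule nn_integral_cmult) measurable
  also have "\<dots> < \<infinity>"
    using J_finite by (simp add: ennreal_mult_less_top)
  finally show "(\<integral>\<^sup>+ x. ennreal (cmod (case_prod kernel_integrand x)) \<partial>((N \<Otimes>\<^sub>M M) \<Otimes>\<^sub>M lborel)) < \<infinity>" .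
qed

text \<open>Only for almost every \<tau> does Fubini make the slice integrable over the product of
  the two measures, and only then can the slice integral be unfolded into the iterated integral
  \<open>dbl\<close>.\<close>

lemma AE_dbl_eq: "AE \<tau> in lborel. (\<integral>p. kernel_integrand p \<tau> \<partial>(N \<Otimes>\<^sub>M M)) = dbl a b M f N g \<tau> * \<phi> \<tau>"
  using Q.AE_integrable_snd[OF integrable_kernel_integrand]
proof eventually_elim
  case (elim \<tau>)
  from integral_fst'[OF elim] show ?case
    unfolding dbl_eq_beta_kernel integral_mult_left_zero[symmetric] by (simp add: kernel_integrand_def mult.assoc)
qed

lemma integrable_dbl: "integrable lborel (\<lambda>\<tau>. dbl a b M f N g \<tau> * \<phi> \<tau>)"
  by (rule integrable_cong_AE_imp[OF Q.integrable_snd[OF integrable_kernel_integrand]])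
     (use AE_dbl_eq in \<open>auto elim: eventually_mono\<close>)

lemma integral_dbl: "(\<integral>\<tau>. dbl a b M f N g \<tau> * \<phi> \<tau> \<partial>lborel)
   = (\<integral>t. (\<integral>s. f s * g t * (\<integral>\<tau>. beta_kernel a b s t \<tau> *\<^sub>R \<phi> \<tau> \<partial>lborel) \<partial>M) \<partial>N)"
proof -
  have "(\<integral>\<tau>. dbl a b M f N g \<tau> * \<phi> \<tau> \<partial>lborel) = (\<integral>\<tau>. (\<integral>p. kernel_integrand p \<tau> \<partial>(N \<Otimes>\<^sub>M M)) \<partial>lborel)"
    using AE_dbl_eq Q.integrable_snd[OF integrable_kernel_integrand]
    by (intro integral_cong_AE) (auto elim: eventually_mono)
  also have "\<dots> = (\<integral>p. (\<integral>\<tau>. kernel_integrand p \<tau> \<partial>lborel) \<partial>(N \<Otimes>\<^sub>M M))"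
    by (rule Q.Fubini_integral[OF integrable_kernel_integrand])
  also have "\<dots> = (\<integral>t. (\<integral>s. (\<integral>\<tau>. kernel_integrand (t, s) \<tau> \<partial>lborel) \<partial>M) \<partial>N)"
    by (rule integral_fst'[OF Q.integrable_fst[OF integrable_kernel_integrand], symmetric])
  finally show ?thesis
    unfolding kernel_integrand_def integral_mult_right_zero[symmetric] by simp
qed

end

lemma integrable_dbl_weight:
  "integrable lborel (\<lambda>\<tau>. dbl a b M f N g \<tau> * of_real ((1 + \<bar>\<tau>\<bar>) powr (- (a + b))))"
  by (rule integrable_dbl[of _ 1]) auto

lemma cauchy_dbl:
  assumes z: "Im z > 0"
  shows integrable_cauchy_dbl: "integrable lborel (\<lambda>\<tau>. dbl a b M f N g \<tau> * (z + of_real \<tau>) powr (- of_real (a + b)))"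
    and integral_cauchy_dbl: "(\<integral>\<tau>. dbl a b M f N g \<tau> * (z + of_real \<tau>) powr (- of_real (a + b)) \<partial>lborel)
     = of_real (Beta a b) * (\<integral>t. (\<integral>s. indicator {..<t} s *\<^sub>R (f s * (z + of_real s) powr (- of_real a) *
            (g t * (z + of_real t) powr (- of_real b))) \<partial>M) \<partial>N)"
proof -
  obtain C where C: "C > 0" "\<And>t. cmod ((z + of_real t) powr (- of_real (a + b))) \<le> C * (1 + \<bar>t\<bar>) powr (- (a + b))"
    using cmod_powr_neg_bound[OF z, of "a + b"] a_pos b_pos by auto
  note * = borel_measurable_powr_upper_half_plane[OF z] less_imp_le[OF C(1)] C(2)
  show "integrable lborel (\<lambda>\<tau>. dbl a b M f N g \<tau> * (z + of_real \<tau>) powr (- of_real (a + b)))"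
    by (rule integrable_dbl[OF *])
  \<comment> \<open>The kernel vanishes for s \<ge> t, and this is where the indicator in the result
    comes from.\<close>
  have "f s * g t * (\<integral>\<tau>. beta_kernel a b s t \<tau> *\<^sub>R (z + of_real \<tau>) powr (- of_real (a + b)) \<partial>lborel)
    = of_real (Beta a b) * (indicator {..<t} s *\<^sub>R (f s * (z + of_real s) powr (- of_real a) *
            (g t * (z + of_real t) powr (- of_real b))))" for s t
  proof (cases "s < t")
    case False
    then have "beta_kernel a b s t \<tau> = 0" for \<tau> by (auto simp: beta_kernel_def)
    then show ?thesis using False by simp
  qed (subst feynman_kernel[OF a_pos b_pos z], auto)
  then show "(\<integral>\<tau>. dbl a b M f N g \<tau> * (z + of_real \<tau>) powr (- of_real (a + b)) \<partial>lborel)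
     = of_real (Beta a b) * (\<integral>t. (\<integral>s. indicator {..<t} s *\<^sub>R (f s * (z + of_real s) powr (- of_real a) *
            (g t * (z + of_real t) powr (- of_real b))) \<partial>M) \<partial>N)"
    unfolding integral_mult_right_zero[symmetric] integral_dbl[OF *] by simp
qed

end


section \<open>Sums of measures and polar decomposition\<close>

text \<open>The sigma-algebra is taken from \<open>M\<close>; the construction is meant for summands
  with the same measurable sets.\<close>

definition sum_measure :: "'a measure \<Rightarrow> 'a measure \<Rightarrow> 'a measure" where
  "sum_measure M N = measure_of (space M) (sets M) (\<lambda>A. emeasure M A + emeasure N A)"

lemma space_sum_measure [simp]: "space (sum_measure M N) = space M"
  and sets_sum_measure [simp, measurable_cong]: "sets (sum_measure M N) = sets M"
  by (simp_all add: sum_measure_def)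

lemma emeasure_sum_measure:
  assumes "sets N = sets M" "A \<in> sets M"
  shows "emeasure (sum_measure M N) A = emeasure M A + emeasure N A"
proof (rule emeasure_measure_of[OF sum_measure_def])
  show "countably_additive (sets (sum_measure M N)) (\<lambda>A. emeasure M A + emeasure N A)"
  proof (rule countably_additiveI)
    fix A :: "nat \<Rightarrow> 'a set"
    assume "range A \<subseteq> sets (sum_measure M N)" "disjoint_family A"
    then show "(\<Sum>i. emeasure M (A i) + emeasure N (A i)) = emeasure M (\<Union> (range A)) + emeasure N (\<Union> (range A))"
      using assms by (subst suminf_add[symmetric]) (auto simp: suminf_emeasure)
  qed
qed (use assms in \<open>auto simp: positive_def dest: sets.sets_into_space\<close>)

lemma nn_integral_sum_measure:
  assumes sets: "sets N = sets M" and f: "f \<in> borel_measurable M"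
  shows "(\<integral>\<^sup>+ x. f x \<partial>sum_measure M N) = (\<integral>\<^sup>+ x. f x \<partial>M) + (\<integral>\<^sup>+ x. f x \<partial>N)"
  using f
proof induction
  case (cong f g)
  then show ?case
    using sets_eq_imp_space_eq[OF sets] by (metis nn_integral_cong space_sum_measure)
next
  case (set A)
  then show ?case using sets by (simp add: emeasure_sum_measure)
next
  case (mult f c)
  then show ?case
    using sets by (simp add: nn_integral_cmult distrib_left cong: measurable_cong_sets)
next
  case (add f g)
  then show ?case
    using sets by (simp add: nn_integral_add add_ac cong: measurable_cong_sets)
next
  case (seq F)
  have [measurable]: "F i \<in> borel_measurable N" "F i \<in> borel_measurable M" for i
    using seq(1) sets by (auto cong: measurable_cong_sets)
  have inc: "incseq (\<lambda>i. \<integral>\<^sup>+ x. F i x \<partial>M)" "incseq (\<lambda>i. \<integral>\<^sup>+ x. F i x \<partial>N)"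
    using \<open>incseq F\<close> by (auto simp: incseq_def le_fun_def intro!: nn_integral_mono)
  have sup: "(\<integral>\<^sup>+ x. (SUP i. F i) x \<partial>K) = (SUP i. \<integral>\<^sup>+ x. F i x \<partial>K)"
    if "\<And>i. F i \<in> borel_measurable K" for K
    unfolding SUP_apply by (rule nn_integral_monotone_convergence_SUP[OF \<open>incseq F\<close> that])
  have "F i \<in> borel_measurable (sum_measure M N)" for i
    by measurable
  then have "(\<integral>\<^sup>+ x. (SUP i. F i) x \<partial>sum_measure M N) = (SUP i. \<integral>\<^sup>+ x. F i x \<partial>sum_measure M N)"
    by (rule sup)
  also have "\<dots> = (SUP i. (\<integral>\<^sup>+ x. F i x \<partial>M) + (\<integral>\<^sup>+ x. F i x \<partial>N))"
    using seq by simp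
  also have "\<dots> = (\<integral>\<^sup>+ x. (SUP i. F i) x \<partial>M) + (\<integral>\<^sup>+ x. (SUP i. F i) x \<partial>N)"
    by (subst ennreal_SUP_add[OF inc]) (simp add: sup)
  finally show ?case .
qed

lemma integral_sum_measure:
  fixes f :: "'a \<Rightarrow> 'b::{banach, second_countable_topology}"
  assumes sets: "sets N = sets M" and "integrable M f" "integrable N f"
  shows "integrable (sum_measure M N) f \<and>
     (\<integral>x. f x \<partial>sum_measure M N) = (\<integral>x. f x \<partial>M) + (\<integral>x. f x \<partial>N)"
proof
  have "f \<in> borel_measurable M" using assms by auto
  then show int: "integrable (sum_measure M N) f"
    using assms by (auto simp: integrable_iff_bounded nn_integral_sum_measure cong: measurable_cong_sets)
  have sub: "integrable M g" "integrable N g" if "integrable (sum_measure M N) g" for g :: "'a \<Rightarrow> 'b"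
    using that sets by (auto simp: integrable_iff_bounded nn_integral_sum_measure cong: measurable_cong_sets)
  show "(\<integral>x. f x \<partial>sum_measure M N) = (\<integral>x. f x \<partial>M) + (\<integral>x. f x \<partial>N)"
    using int
  proof induction
    case (base A c)
    then have "A \<in> sets M" "emeasure M A < \<infinity>" "emeasure N A < \<infinity>" "A \<in> sets N"
      using sets by (auto simp: emeasure_sum_measure)
    moreover have "measure (sum_measure M N) A = measure M A + measure N A"
      using calculation sets unfolding measure_def by (simp add: emeasure_sum_measure enn2real_plus)
    ultimately show ?case using base by (simp add: scaleR_add_left)
  next
    case (add f g)
    then show ?case by (simp add: sub)
  next
    case (lim f s)
    have s: "s i \<in> borel_measurable M" "s i \<in> borel_measurable N" for i
      using sub[OF lim.hyps(1)[of i]] by auto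
    have sp: "space N = space M" by (rule sets_eq_imp_space_eq[OF sets])
    have f: "integrable M f" "integrable N f" using sub[OF lim.hyps(4)] .
    \<comment> \<open>The majorant of twice the norm of \<open>f\<close> comes from the induction
      principle for integrable functions. It works for all three measures because integrability for
      the sum passes to each summand.\<close>
    have "(\<lambda>i. integral\<^sup>L M (s i)) \<longlonglongrightarrow> integral\<^sup>L M f"
      by (rule integral_dominated_convergence[where w = "\<lambda>x. 2 * norm (f x)"])
         (use lim.hyps(2,3) f s in auto)
    moreover have "(\<lambda>i. integral\<^sup>L N (s i)) \<longlonglongrightarrow> integral\<^sup>L N f"
      by (rule integral_dominated_convergence[where w = "\<lambda>x. 2 * norm (f x)"])
         (use lim.hyps(2,3) f s sp in auto)
    ultimately have "(\<lambda>i. integral\<^sup>L (sum_measure M N) (s i)) \<longlonglongrightarrow> integral\<^sup>L M f + integral\<^sup>L N f"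
      unfolding lim.IH by (rule tendsto_add)
    moreover have "(\<lambda>i. integral\<^sup>L (sum_measure M N) (s i)) \<longlonglongrightarrow> integral\<^sup>L (sum_measure M N) f"
      by (rule integral_dominated_convergence[where w = "\<lambda>x. 2 * norm (f x)"])
         (use lim.hyps in auto)
    ultimately show ?case
      using LIMSEQ_unique by blast
  qed
qed

text \<open>Mutual singularity (\<open>v\<close> vanishes almost everywhere for \<open>M\<close>) lets one phase function serve both parts.\<close>

lemma polar_decomposition_sum:
  fixes M N :: "real measure" and u v :: "real \<Rightarrow> complex"
  assumes sets [measurable_cong, simp]: "sets M = sets borel" "sets N = sets borel"
    and [measurable]: "u \<in> borel_measurable borel" "v \<in> borel_measurable borel"
    and sing: "AE x in M. v x = 0"
  obtains \<nu> h where "sets \<nu> = sets borel" "h \<in> borel_measurable borel" "\<And>x. cmod (h x) = 1"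
    "\<And>\<phi>. \<phi> \<in> borel_measurable borel \<Longrightarrow> (\<integral>\<^sup>+ x. \<phi> x \<partial>\<nu>) = (\<integral>\<^sup>+ x. \<phi> x * ennreal (cmod (u x)) \<partial>M) + (\<integral>\<^sup>+ x. \<phi> x * ennreal (cmod (v x)) \<partial>N)"
    "\<And>\<phi>. \<phi> \<in> borel_measurable borel \<Longrightarrow> integrable M (\<lambda>x. \<phi> x * u x) \<Longrightarrow> integrable N (\<lambda>x. \<phi> x * v x) \<Longrightarrow>
       (\<integral>x. \<phi> x * h x \<partial>\<nu>) = (\<integral>x. \<phi> x * u x \<partial>M) + (\<integral>x. \<phi> x * v x \<partial>N)"
    "(AE x in M. u x \<in> \<real>\<^sub>\<ge>\<^sub>0) \<Longrightarrow> (AE x in N. v x \<in> \<real>\<^sub>\<ge>\<^sub>0) \<Longrightarrow> (AE x in \<nu>. h x = 1)"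
proof -
  \<comment> \<open>The order of the tests matters. Where \<open>v\<close> is nonzero its phase
    wins, which costs nothing for \<open>M\<close> since that set is \<open>M\<close>-null; where
    \<open>v\<close> is zero the density of the second part vanishes, so the phase of
    \<open>u\<close> may be used. The last value 1 keeps the modulus equal to 1 and agrees with the
    positive case.\<close>
  define h where "h \<equiv> \<lambda>x. if v x \<noteq> 0 then sgn (v x) else if u x \<noteq> 0 then sgn (u x) else 1"
  define M' where "M' = density M (\<lambda>x. ennreal (cmod (u x)))"
  define N' where "N' = density N (\<lambda>x. ennreal (cmod (v x)))"
  have [measurable_cong, simp]: "sets M' = sets borel" "sets N' = sets borel"
    by (simp_all add: M'_def N'_def)
  have h [measurable]: "h \<in> borel_measurable borel"
    unfolding h_def sgn_div_norm by measurable
  have nn: "(\<integral>\<^sup>+ x. \<phi> x \<partial>sum_measure M' N') = (\<integral>\<^sup>+ x. \<phi> x * ennreal (cmod (u x)) \<partial>M) + (\<integral>\<^sup>+ x. \<phi> x * ennreal (cmod (v x)) \<partial>N)"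
    if [measurable]: "\<phi> \<in> borel_measurable borel" for \<phi>
    by (simp add: nn_integral_sum_measure M'_def N'_def nn_integral_density mult.commute)
  have hv: "cmod (v x) *\<^sub>R h x = v x" for x
    by (simp add: h_def sgn_div_norm)
  have hu: "AE x in M. cmod (u x) *\<^sub>R h x = u x"
    using sing by eventually_elim (simp add: h_def sgn_div_norm)
  show thesis
  proof (rule that[of "sum_measure M' N'" h])
    show "sets (sum_measure M' N') = sets borel" by simp
    show "cmod (h x) = 1" for x by (simp add: h_def norm_sgn)
  next
    fix \<phi> :: "real \<Rightarrow> complex"
    assume [measurable]: "\<phi> \<in> borel_measurable borel"
      and int: "integrable M (\<lambda>x. \<phi> x * u x)" "integrable N (\<lambda>x. \<phi> x * v x)"
    have eqN: "(\<lambda>x. cmod (v x) *\<^sub>R (\<phi> x * h x)) = (\<lambda>x. \<phi> x * v x)"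
      by (simp only: mult_scaleR_right[symmetric] hv)
    have eqM: "AE x in M. cmod (u x) *\<^sub>R (\<phi> x * h x) = \<phi> x * u x"
      using hu by eventually_elim (simp only: mult_scaleR_right[symmetric])
    have "integrable M' (\<lambda>x. \<phi> x * h x)"
      unfolding M'_def using eqM int
      by (subst integrable_density) (auto intro: integrable_cong_AE_imp elim: eventually_mono)
    moreover have "integrable N' (\<lambda>x. \<phi> x * h x)"
      unfolding N'_def using int by (subst integrable_density) (auto simp: eqN)
    moreover have "(\<integral>x. \<phi> x * h x \<partial>M') = (\<integral>x. \<phi> x * u x \<partial>M)"
      unfolding M'_def using eqM by (subst integral_density) (auto intro!: integral_cong_AE)
    moreover have "(\<integral>x. \<phi> x * h x \<partial>N') = (\<integral>x. \<phi> x * v x \<partial>N)"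
      unfolding N'_def by (subst integral_density) (auto simp: eqN)
    ultimately show "(\<integral>x. \<phi> x * h x \<partial>sum_measure M' N') = (\<integral>x. \<phi> x * u x \<partial>M) + (\<integral>x. \<phi> x * v x \<partial>N)"
      using integral_sum_measure[of N' M' "\<lambda>x. \<phi> x * h x"] by simp
  next
    assume pos: "AE x in M. u x \<in> \<real>\<^sub>\<ge>\<^sub>0" "AE x in N. v x \<in> \<real>\<^sub>\<ge>\<^sub>0"
    have sgn1: "sgn w = 1" if "w \<in> \<real>\<^sub>\<ge>\<^sub>0" "w \<noteq> 0" for w :: complex
      using that by (auto elim!: nonneg_Reals_cases simp: sgn_of_real)
    have "AE x in M. indicator {x. h x \<noteq> 1} x * ennreal (cmod (u x)) = 0"
      using sing pos(1) by eventually_elim (auto simp: h_def indicator_def sgn1)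
    moreover have "AE x in N. indicator {x. h x \<noteq> 1} x * ennreal (cmod (v x)) = 0"
      using pos(2) by eventually_elim (auto simp: h_def indicator_def sgn1)
    \<comment> \<open>Testing with the indicator of the points where \<open>h\<close> differs from 1
      shows that this set is null for both parts.\<close>
    ultimately have "(\<integral>\<^sup>+ x. indicator {x. h x \<noteq> 1} x \<partial>sum_measure M' N') = 0"
      by (subst nn) (simp_all add: nn_integral_0_iff_AE)
    then show "AE x in sum_measure M' N'. h x = 1"
      by (subst (asm) nn_integral_0_iff_AE) (auto simp: indicator_def elim: eventually_mono)
  qed (fact h nn)+
qed

section \<open>Local finiteness and atoms\<close>

lemma locally_finite_imp_sigma_finite:
  assumes "sets M = sets (borel :: real measure)" and "\<And>K. compact K \<Longrightarrow> emeasure M K < \<infinity>"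
  shows "sigma_finite_measure M"
proof
  have "(\<Union>n::nat. {- real n..real n}) = UNIV"
    by (auto simp: set_eq_iff) (metis abs_le_iff minus_le_iff real_arch_simple)
  moreover have "emeasure M {- real n..real n} \<noteq> top" for n :: nat
    using assms(2)[of "{- real n..real n}"] by (simp add: less_top)
  ultimately show "\<exists>A. countable A \<and> A \<subseteq> sets M \<and> \<Union>A = space M \<and> (\<forall>a\<in>A. emeasure M a \<noteq> \<infinity>)"
    using assms(1) sets_eq_imp_space_eq[OF assms(1)]
    by (intro exI[of _ "range (\<lambda>n::nat. {- real n..real n})"]) auto
qed

text \<open>The mass of a point is the mass of a section of the diagonal, hence measurable in the
  point. Integrating it over the line and exchanging the integrals leaves the Lebesgue measure of
  single points, which is zero; an enumeration of the atoms is thereby avoided.\<close>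

lemma borel_measurable_measure_singleton:
  assumes "sigma_finite_measure M" and [measurable_cong, simp]: "sets M = sets (borel :: real measure)"
  shows "(\<lambda>x. measure M {x}) \<in> borel_measurable borel"
    and "AE x in lborel. measure M {x} = 0"
proof -
  interpret sigma_finite_measure M by fact
  interpret pair_sigma_finite M lborel ..
  have eq: "emeasure M {x} = (\<integral>\<^sup>+ y. indicator {p. fst p = snd p} (y, x) \<partial>M)" for x
  proof -
    have "emeasure M {x} = (\<integral>\<^sup>+ y. indicator {x} y \<partial>M)" by simp
    also have "\<dots> = (\<integral>\<^sup>+ y. indicator {p. fst p = snd p} (y, x) \<partial>M)"
      by (intro nn_integral_cong) (auto simp: indicator_def)
    finally show ?thesis .
  qed
  have [measurable]: "(\<lambda>x. emeasure M {x}) \<in> borel_measurable borel"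
    unfolding eq by measurable
  then show "(\<lambda>x. measure M {x}) \<in> borel_measurable borel"
    unfolding measure_def by measurable
  have "(\<integral>\<^sup>+ x. emeasure M {x} \<partial>lborel) = (\<integral>\<^sup>+ y. (\<integral>\<^sup>+ x. indicator {p. fst p = snd p} (y, x) \<partial>lborel) \<partial>M)"
    unfolding eq by (rule Fubini') measurable
  also have "\<dots> = (\<integral>\<^sup>+ y. (\<integral>\<^sup>+ x. indicator {y} x \<partial>lborel) \<partial>M)"
    by (intro nn_integral_cong) (auto simp: indicator_def)
  also have "\<dots> = 0" by simp
  finally have "AE x in lborel. emeasure M {x} = 0"
    by (subst (asm) nn_integral_0_iff_AE) auto
  then show "AE x in lborel. measure M {x} = 0"
    by eventually_elim (simp add: measure_def)
qed


section \<open>Products of Cauchy transforms\<close>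

lemma integral_indicator_singleton:
  fixes c :: "real \<Rightarrow> complex"
  assumes "sets M = sets borel" "emeasure M {t} < \<infinity>"
  shows "(\<integral>s. indicator {t} s *\<^sub>R c s \<partial>M) = measure M {t} *\<^sub>R c t"
proof -
  have "(\<integral>s. indicator {t} s *\<^sub>R c s \<partial>M) = (\<integral>s. indicator {t} s *\<^sub>R c t \<partial>M)"
    by (intro Bochner_Integration.integral_cong refl) (auto simp: indicator_def)
  also have "\<dots> = measure M {t} *\<^sub>R c t"
    using assms sets_eq_imp_space_eq[OF assms(1)] by (simp add: integral_scaleR_left)
  finally show ?thesis .
qed

lemma (in pair_sigma_finite) integrable_product:
  fixes F G :: "_ \<Rightarrow> complex"
  assumes F: "integrable M1 F" and G: "integrable M2 G"
  shows "integrable (M1 \<Otimes>\<^sub>M M2) (\<lambda>(x, y). G y * F x)"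
proof (rule Fubini_integrable)
  have [measurable]: "F \<in> borel_measurable M1" "G \<in> borel_measurable M2" using F G by auto
  show "(\<lambda>(x, y). G y * F x) \<in> borel_measurable (M1 \<Otimes>\<^sub>M M2)" by measurable
  show "integrable M1 (\<lambda>x. \<integral>y. norm (case (x, y) of (x, y) \<Rightarrow> G y * F x) \<partial>M2)"
    using F by (simp add: norm_mult)
  show "AE x in M1. integrable M2 (\<lambda>y. case (x, y) of (x, y) \<Rightarrow> G y * F x)"
    using G by simp
qed

text \<open>Each off-diagonal part has the larger variable outside, the form in which the triangle
  integrals produce it. On the diagonal the integral over \<open>M\<close> is done first and leaves
  its atom at t as a factor against \<open>N\<close>; this is the source of the asymmetric form of
  the atomic part. Its integrability is inherited from the product.\<close>

lemma integral_product_split_diagonal: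
  fixes M N :: "real measure" and F G :: "real \<Rightarrow> complex"
  assumes sf: "sigma_finite_measure M" "sigma_finite_measure N"
    and sets [measurable_cong, simp]: "sets M = sets borel" "sets N = sets borel"
    and fin: "\<And>t. emeasure M {t} < \<infinity>"
    and F: "integrable N F" and G: "integrable M G"
  shows "(\<integral>s. G s \<partial>M) * (\<integral>t. F t \<partial>N) =
      (\<integral>t. (\<integral>s. indicator {..<t} s *\<^sub>R (G s * F t) \<partial>M) \<partial>N)
    + (\<integral>s. (\<integral>t. indicator {..<s} t *\<^sub>R (F t * G s) \<partial>N) \<partial>M)
    + (\<integral>t. measure M {t} *\<^sub>R (G t * F t) \<partial>N)"
    and "integrable N (\<lambda>t. measure M {t} *\<^sub>R (G t * F t))"
proof -
  interpret M: sigma_finite_measure M by fact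
  interpret N: sigma_finite_measure N by fact
  interpret pair_sigma_finite N M ..
  define H where "H \<equiv> \<lambda>p. G (snd p) * F (fst p)"
  have H: "integrable (N \<Otimes>\<^sub>M M) H"
    using integrable_product[OF F G] by (simp add: H_def case_prod_beta')
  have ind: "integrable (N \<Otimes>\<^sub>M M) (\<lambda>p. indicator S p *\<^sub>R H p)" if "S \<in> sets (N \<Otimes>\<^sub>M M)" for S
    using H that by (rule integrable_mult_indicator[rotated])
  let ?L = "{p :: real \<times> real. snd p < fst p}" and ?U = "{p :: real \<times> real. fst p < snd p}"
    and ?D = "{p :: real \<times> real. fst p = snd p}"
  have sets_NM: "sets (N \<Otimes>\<^sub>M M) = sets borel"
    using sets_pair_measure_cong[OF sets(2,1)] unfolding borel_prod .
  have S: "?L \<in> sets (N \<Otimes>\<^sub>M M)" "?U \<in> sets (N \<Otimes>\<^sub>M M)" "?D \<in> sets (N \<Otimes>\<^sub>M M)"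
    unfolding sets_NM
    by (intro borel_open open_Collect_less borel_closed closed_Collect_eq continuous_intros)+
  have "(\<integral>s. G s \<partial>M) * (\<integral>t. F t \<partial>N) = (\<integral>t. (\<integral>s. H (t, s) \<partial>M) \<partial>N)"
    by (simp add: H_def)
  also have "\<dots> = (\<integral>p. H p \<partial>(N \<Otimes>\<^sub>M M))"
    by (rule integral_fst'[OF H])
  also have "\<dots> = (\<integral>p. indicator ?L p *\<^sub>R H p + indicator ?U p *\<^sub>R H p + indicator ?D p *\<^sub>R H p \<partial>(N \<Otimes>\<^sub>M M))"
    by (intro Bochner_Integration.integral_cong refl) (auto simp: indicator_def)
  also have "\<dots> = (\<integral>p. indicator ?L p *\<^sub>R H p \<partial>(N \<Otimes>\<^sub>M M)) + (\<integral>p. indicator ?U p *\<^sub>R H p \<partial>(N \<Otimes>\<^sub>M M))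
      + (\<integral>p. indicator ?D p *\<^sub>R H p \<partial>(N \<Otimes>\<^sub>M M))"
    using ind[OF S(1)] ind[OF S(2)] ind[OF S(3)] by simp
  also have "(\<integral>p. indicator ?L p *\<^sub>R H p \<partial>(N \<Otimes>\<^sub>M M)) = (\<integral>t. (\<integral>s. indicator {..<t} s *\<^sub>R (G s * F t) \<partial>M) \<partial>N)"
    unfolding integral_fst'[OF ind[OF S(1)], symmetric]
    by (intro Bochner_Integration.integral_cong refl) (auto simp: H_def indicator_def)
  \<comment> \<open>This half is integrated in the opposite order, to bring the larger variable s
    outside.\<close>
  also have "(\<integral>p. indicator ?U p *\<^sub>R H p \<partial>(N \<Otimes>\<^sub>M M)) = (\<integral>s. (\<integral>t. indicator {..<s} t *\<^sub>R (F t * G s) \<partial>N) \<partial>M)"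
  proof -
    have "integrable (N \<Otimes>\<^sub>M M) (\<lambda>(t, s). indicator ?U (t, s) *\<^sub>R H (t, s))"
      using ind[OF S(2)] by (simp add: case_prod_beta')
    from integral_snd[OF this] have "(\<integral>p. indicator ?U p *\<^sub>R H p \<partial>(N \<Otimes>\<^sub>M M))
       = (\<integral>s. (\<integral>t. indicator ?U (t, s) *\<^sub>R H (t, s) \<partial>N) \<partial>M)"
      by (simp add: case_prod_beta')
    also have "\<dots> = (\<integral>s. (\<integral>t. indicator {..<s} t *\<^sub>R (F t * G s) \<partial>N) \<partial>M)"
      by (intro Bochner_Integration.integral_cong refl) (auto simp: H_def indicator_def mult.commute)
    finally show ?thesis .
  qed
  also have diag: "(\<integral>s. indicator ?D (t, s) *\<^sub>R H (t, s) \<partial>M) = measure M {t} *\<^sub>R (G t * F t)" for t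
  proof -
    have "(\<integral>s. indicator ?D (t, s) *\<^sub>R H (t, s) \<partial>M) = (\<integral>s. indicator {t} s *\<^sub>R (G s * F t) \<partial>M)"
      by (intro Bochner_Integration.integral_cong refl) (auto simp: H_def indicator_def)
    then show ?thesis
      using integral_indicator_singleton[OF sets(1) fin, of t "\<lambda>s. G s * F t"] by simp
  qed
  have "(\<integral>p. indicator ?D p *\<^sub>R H p \<partial>(N \<Otimes>\<^sub>M M)) = (\<integral>t. measure M {t} *\<^sub>R (G t * F t) \<partial>N)"
    unfolding integral_fst'[OF ind[OF S(3)], symmetric] diag ..
  finally show "(\<integral>s. G s \<partial>M) * (\<integral>t. F t \<partial>N) =
      (\<integral>t. (\<integral>s. indicator {..<t} s *\<^sub>R (G s * F t) \<partial>M) \<partial>N)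
    + (\<integral>s. (\<integral>t. indicator {..<s} t *\<^sub>R (F t * G s) \<partial>N) \<partial>M)
    + (\<integral>t. measure M {t} *\<^sub>R (G t * F t) \<partial>N)" .
  show "integrable N (\<lambda>t. measure M {t} *\<^sub>R (G t * F t))"
    using integrable_fst'[OF ind[OF S(3)]] unfolding diag .
qed

section \<open>Test functions dominated by the weight\<close>

lemma integrable_weighted:
  fixes \<phi> w :: "real \<Rightarrow> complex"
  assumes [measurable_cong, simp]: "sets M = sets borel"
    and [measurable]: "\<phi> \<in> borel_measurable borel" "w \<in> borel_measurable borel"
    and C: "C \<ge> 0" "\<And>x. cmod (\<phi> x) \<le> C * (1 + \<bar>x\<bar>) powr (- r)"
    and fin: "(\<integral>\<^sup>+ x. ennreal ((1 + \<bar>x\<bar>) powr (- r)) * ennreal (cmod (w x)) \<partial>M) < \<infinity>"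
  shows "integrable M (\<lambda>x. \<phi> x * w x)"
proof (rule integrableI_bounded)
  have "(\<integral>\<^sup>+ x. ennreal (cmod (\<phi> x * w x)) \<partial>M)
    \<le> (\<integral>\<^sup>+ x. ennreal C * (ennreal ((1 + \<bar>x\<bar>) powr (- r)) * ennreal (cmod (w x))) \<partial>M)"
    using C by (intro nn_integral_mono)
      (simp add: ennreal_mult[symmetric] norm_mult mult.assoc[symmetric] mult_right_mono)
  also have "\<dots> < \<infinity>"
    using fin by (simp add: nn_integral_cmult ennreal_mult_less_top)
  finally show "(\<integral>\<^sup>+ x. ennreal (cmod (\<phi> x * w x)) \<partial>M) < \<infinity>" .
qed measurable

text \<open>On a bounded set the weight is bounded below by a positive constant. Indicators of
  bounded sets thus satisfy the same kind of bound as Cauchy kernels and can be handled by the same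
  integrability lemma.\<close>

lemma indicator_bounded_le_weight:
  fixes A :: "real set"
  assumes "bounded A" "r \<ge> 0"
  obtains C where "C \<ge> 0" "\<And>x. indicator A x \<le> C * (1 + \<bar>x\<bar>) powr (- r)"
proof -
  obtain R where R: "\<And>x. x \<in> A \<Longrightarrow> \<bar>x\<bar> \<le> R" "R > 0"
    using assms(1) by (metis bounded_pos real_norm_def)
  show ?thesis
  proof
    fix x
    show "indicator A x \<le> (1 + R) powr r * (1 + \<bar>x\<bar>) powr (- r)"
    proof (cases "x \<in> A")
      case True
      then have "(1 + \<bar>x\<bar>) powr r \<le> (1 + R) powr r"
        using R assms(2) by (intro powr_mono2) auto
      then show ?thesis using True by (simp add: powr_minus field_simps)
    qed auto
  qed auto
qed

lemma M_alphaD: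
  assumes "M_alpha \<alpha> \<nu> h"
  shows "sets \<nu> = sets borel" "h \<in> borel_measurable borel" "\<And>x. cmod (h x) = 1"
    "\<And>K. compact K \<Longrightarrow> emeasure \<nu> K < \<infinity>" "sigma_finite_measure \<nu>"
    "(\<integral>\<^sup>+ t. ennreal ((1 + \<bar>t\<bar>) powr (- \<alpha>)) \<partial>\<nu>) < \<infinity>"
  using assms locally_finite_imp_sigma_finite[of \<nu>] unfolding M_alpha_def cradon_def by auto

lemma cauchy_tr_eq:
  "cauchy_tr \<alpha> \<nu> h z = (\<integral>t. h t * (z + of_real t) powr (- of_real \<alpha>) \<partial>\<nu>)"
  by (simp add: cauchy_tr_def powr_minus divide_inverse)

lemma integrable_cauchy:
  assumes M: "M_alpha \<alpha> \<nu> h" and "\<alpha> > 0" and z: "Im z > 0"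
  shows "integrable \<nu> (\<lambda>t. h t * (z + of_real t) powr (- of_real \<alpha>))"
proof -
  note D = M_alphaD[OF M]
  obtain C where C: "C > 0" "\<And>t. cmod ((z + of_real t) powr (- of_real \<alpha>)) \<le> C * (1 + \<bar>t\<bar>) powr (- \<alpha>)"
    using cmod_powr_neg_bound[OF z, of \<alpha>] assms by auto
  have "integrable \<nu> (\<lambda>t. (z + of_real t) powr (- of_real \<alpha>) * h t)"
    by (rule integrable_weighted[OF D(1) borel_measurable_powr_upper_half_plane[OF z] D(2) _ C(2)])
       (use C D in simp_all)
  then show ?thesis by (simp add: mult.commute)
qed

lemma cmeas_singleton:
  assumes "M_alpha \<alpha> \<nu> h"
  shows "cmeas \<nu> h {x} = measure \<nu> {x} *\<^sub>R h x"
  unfolding cmeas_def set_lebesgue_integral_def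
  using M_alphaD[OF assms] by (intro integral_indicator_singleton) auto

text \<open>One point contributes at most the whole integral. The bound is uniform in the point, as
  needed to integrate the atoms of one measure against the other.\<close>

lemma weight_measure_singleton_le:
  assumes "M_alpha \<alpha> \<nu> h"
  shows "ennreal ((1 + \<bar>x\<bar>) powr (- \<alpha>)) * ennreal (measure \<nu> {x}) \<le> (\<integral>\<^sup>+ t. ennreal ((1 + \<bar>t\<bar>) powr (- \<alpha>)) \<partial>\<nu>)"
proof -
  note D = M_alphaD[OF assms]
  have [simp]: "emeasure \<nu> {x} = ennreal (measure \<nu> {x})"
    using D(4)[of "{x}"] by (simp add: emeasure_eq_ennreal_measure less_top)
  have "ennreal ((1 + \<bar>x\<bar>) powr (- \<alpha>)) * ennreal (measure \<nu> {x})
    = (\<integral>\<^sup>+ t. ennreal ((1 + \<bar>x\<bar>) powr (- \<alpha>)) * indicator {x} t \<partial>\<nu>)"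
    using D(1) by (simp add: nn_integral_cmult_indicator)
  also have "\<dots> \<le> (\<integral>\<^sup>+ t. ennreal ((1 + \<bar>t\<bar>) powr (- \<alpha>)) \<partial>\<nu>)"
    by (intro nn_integral_mono) (auto simp: indicator_def)
  finally show ?thesis .
qed

text \<open>Each phase may be replaced by 1 under its own integral, which leaves an iterated
  integral of a nonnegative kernel. This works at every \<tau>, since the default value 0 of a
  divergent integral is nonnegative as well.\<close>

lemma (in triangle) dbl_nonneg:
  assumes f: "AE x in M. f x = 1" and g: "AE x in N. g x = 1"
  shows "dbl a b M f N g \<tau> \<in> \<real>\<^sub>\<ge>\<^sub>0"
proof -
  have inner: "(\<integral>s. beta_kernel a b s t \<tau> *\<^sub>R (f s * g t) \<partial>M) = of_real (\<integral>s. beta_kernel a b s t \<tau> \<partial>M) * g t" for t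
  proof -
    have "(\<integral>s. beta_kernel a b s t \<tau> *\<^sub>R (f s * g t) \<partial>M) = (\<integral>s. of_real (beta_kernel a b s t \<tau>) * g t \<partial>M)"
      using f by (intro integral_cong_AE) (auto elim!: eventually_mono simp: scaleR_conv_of_real)
    then show ?thesis by simp
  qed
  have "dbl a b M f N g \<tau> = (\<integral>t. of_real (\<integral>s. beta_kernel a b s t \<tau> \<partial>M) \<partial>N)"
    unfolding dbl_eq_beta_kernel inner using g
    by (intro integral_cong_AE) (auto elim!: eventually_mono)
  also have "\<dots> = of_real (\<integral>t. (\<integral>s. beta_kernel a b s t \<tau> \<partial>M) \<partial>N)" by simp
  finally show ?thesis
    by (simp add: beta_kernel_nonneg)
qed

theorem theorem7p1:
  fixes \<alpha>\<^sub>1 \<alpha>\<^sub>2 :: real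
    and \<nu>\<^sub>1 \<nu>\<^sub>2 :: "real measure" and h\<^sub>1 h\<^sub>2 :: "real \<Rightarrow> complex"
  assumes "\<alpha>\<^sub>1 > 0" "\<alpha>\<^sub>2 > 0"
    and "M_alpha \<alpha>\<^sub>1 \<nu>\<^sub>1 h\<^sub>1" "M_alpha \<alpha>\<^sub>2 \<nu>\<^sub>2 h\<^sub>2"
    and "Jfun \<alpha>\<^sub>1 \<alpha>\<^sub>2 \<nu>\<^sub>1 \<nu>\<^sub>2 < \<infinity>" "Jfun \<alpha>\<^sub>2 \<alpha>\<^sub>1 \<nu>\<^sub>2 \<nu>\<^sub>1 < \<infinity>"
  shows "\<exists>u :: real \<Rightarrow> complex. u \<in> borel_measurable borel \<and>
     (\<forall>A \<in> sets borel. bounded A \<longrightarrow> set_integrable lborel A u) \<and>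
     (AE \<tau> in lborel. complex_of_real (Beta \<alpha>\<^sub>1 \<alpha>\<^sub>2) * u \<tau> =
          dbl \<alpha>\<^sub>1 \<alpha>\<^sub>2 \<nu>\<^sub>1 h\<^sub>1 \<nu>\<^sub>2 h\<^sub>2 \<tau> + dbl \<alpha>\<^sub>2 \<alpha>\<^sub>1 \<nu>\<^sub>2 h\<^sub>2 \<nu>\<^sub>1 h\<^sub>1 \<tau>) \<and>
     (\<exists>\<nu> h. M_alpha (\<alpha>\<^sub>1 + \<alpha>\<^sub>2) \<nu> h \<and>
        (\<forall>A \<in> sets borel. bounded A \<longrightarrow>
           cmeas \<nu> h A = (LINT \<tau>:A|lborel. u \<tau>)
                          + (LINT \<tau>:A|\<nu>\<^sub>2. cmeas \<nu>\<^sub>1 h\<^sub>1 {\<tau>} * h\<^sub>2 \<tau>)) \<and>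
        (\<forall>z. Im z > 0 \<longrightarrow>
           cauchy_tr \<alpha>\<^sub>1 \<nu>\<^sub>1 h\<^sub>1 z * cauchy_tr \<alpha>\<^sub>2 \<nu>\<^sub>2 h\<^sub>2 z = cauchy_tr (\<alpha>\<^sub>1 + \<alpha>\<^sub>2) \<nu> h z) \<and>
        ((AE x in \<nu>\<^sub>1. h\<^sub>1 x = 1) \<and> (AE x in \<nu>\<^sub>2. h\<^sub>2 x = 1) \<longrightarrow> (AE x in \<nu>. h x = 1)))"
proof -
  note D1 = M_alphaD[OF assms(3)] and D2 = M_alphaD[OF assms(4)]
  interpret M1: sigma_finite_measure \<nu>\<^sub>1 by (rule D1)
  interpret M2: sigma_finite_measure \<nu>\<^sub>2 by (rule D2)
  interpret T1: triangle \<nu>\<^sub>1 \<nu>\<^sub>2 h\<^sub>1 h\<^sub>2 \<alpha>\<^sub>1 \<alpha>\<^sub>2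
    by unfold_locales (use assms D1 D2 in auto)
  interpret T2: triangle \<nu>\<^sub>2 \<nu>\<^sub>1 h\<^sub>2 h\<^sub>1 \<alpha>\<^sub>2 \<alpha>\<^sub>1
    by unfold_locales (use assms D1 D2 in auto)
  define \<alpha> where "\<alpha> = \<alpha>\<^sub>1 + \<alpha>\<^sub>2"
  define d1 where "d1 = dbl \<alpha>\<^sub>1 \<alpha>\<^sub>2 \<nu>\<^sub>1 h\<^sub>1 \<nu>\<^sub>2 h\<^sub>2"
  define d2 where "d2 = dbl \<alpha>\<^sub>2 \<alpha>\<^sub>1 \<nu>\<^sub>2 h\<^sub>2 \<nu>\<^sub>1 h\<^sub>1"
  define B where "B = Beta \<alpha>\<^sub>1 \<alpha>\<^sub>2"
  \<comment> \<open>Symmetry of the beta function allows both triangle terms to be divided by the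
    same constant.\<close>
  have B: "B > 0" "Beta \<alpha>\<^sub>2 \<alpha>\<^sub>1 = B"
    using assms(1,2) by (auto simp: B_def Beta_def mult.commute[of "Gamma \<alpha>\<^sub>2"] add.commute[of \<alpha>\<^sub>2] intro!: mult_pos_pos divide_pos_pos Gamma_real_pos)
  define u where "u \<equiv> \<lambda>\<tau>. (d1 \<tau> + d2 \<tau>) / of_real B"
  define v where "v \<equiv> \<lambda>\<tau>. cmeas \<nu>\<^sub>1 h\<^sub>1 {\<tau>} * h\<^sub>2 \<tau>"
  have v_eq: "v \<tau> = measure \<nu>\<^sub>1 {\<tau>} *\<^sub>R (h\<^sub>1 \<tau> * h\<^sub>2 \<tau>)" for \<tau>
    by (simp add: v_def cmeas_singleton[OF assms(3)])
  have [measurable]: "(\<lambda>x. measure \<nu>\<^sub>1 {x}) \<in> borel_measurable borel"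
    by (rule borel_measurable_measure_singleton[OF D1(5,1)])
  have u [measurable]: "u \<in> borel_measurable borel"
    unfolding u_def d1_def d2_def by measurable
  have v [measurable]: "v \<in> borel_measurable borel"
    unfolding v_eq by measurable
  \<comment> \<open>This is the mutual singularity: \<open>v\<close> carries the mass of a point as
    a factor, and Lebesgue-almost every point has mass zero.\<close>
  have v_null: "AE x in lborel. v x = 0"
    using borel_measurable_measure_singleton(2)[OF D1(5,1)] by eventually_elim (simp add: v_eq)

  have "integrable lborel (\<lambda>\<tau>. u \<tau> * of_real ((1 + \<bar>\<tau>\<bar>) powr (- \<alpha>)))"
  proof -
    have "integrable lborel (\<lambda>\<tau>. (d1 \<tau> * of_real ((1 + \<bar>\<tau>\<bar>) powr (- \<alpha>)) + d2 \<tau> * of_real ((1 + \<bar>\<tau>\<bar>) powr (- \<alpha>))) / of_real B)"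
      using T1.integrable_dbl_weight T2.integrable_dbl_weight
      unfolding \<alpha>_def d1_def d2_def add.commute[of \<alpha>\<^sub>2] by (intro integrable_divide Bochner_Integration.integrable_add)
    then show ?thesis by (simp add: u_def field_simps)
  qed
  then have u_fin: "(\<integral>\<^sup>+ x. ennreal ((1 + \<bar>x\<bar>) powr (- \<alpha>)) * ennreal (cmod (u x)) \<partial>lborel) < \<infinity>"
    by (simp add: integrable_iff_bounded norm_mult ennreal_mult mult.commute)
  \<comment> \<open>The weight is split by exponent: the power \<open>- \<alpha>\<^sub>1\<close>
    pays for the atom of \<open>\<nu>\<^sub>1\<close>, uniformly in x, and the power
    \<open>- \<alpha>\<^sub>2\<close> is integrable against \<open>\<nu>\<^sub>2\<close>.\<close>
  have v_fin: "(\<integral>\<^sup>+ x. ennreal ((1 + \<bar>x\<bar>) powr (- \<alpha>)) * ennreal (cmod (v x)) \<partial>\<nu>\<^sub>2) < \<infinity>"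
  proof -
    let ?I = "\<integral>\<^sup>+ t. ennreal ((1 + \<bar>t\<bar>) powr (- \<alpha>\<^sub>1)) \<partial>\<nu>\<^sub>1"
    have "(\<integral>\<^sup>+ x. ennreal ((1 + \<bar>x\<bar>) powr (- \<alpha>)) * ennreal (cmod (v x)) \<partial>\<nu>\<^sub>2)
      \<le> (\<integral>\<^sup>+ x. ?I * ennreal ((1 + \<bar>x\<bar>) powr (- \<alpha>\<^sub>2)) \<partial>\<nu>\<^sub>2)"
    proof (intro nn_integral_mono)
      fix x
      have "ennreal ((1 + \<bar>x\<bar>) powr (- \<alpha>)) * ennreal (cmod (v x)) =
        ennreal ((1 + \<bar>x\<bar>) powr (- \<alpha>\<^sub>1)) * ennreal (measure \<nu>\<^sub>1 {x}) * ennreal ((1 + \<bar>x\<bar>) powr (- \<alpha>\<^sub>2))"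
        by (simp add: v_eq norm_mult D1 D2 \<alpha>_def ennreal_mult[symmetric] powr_add[symmetric] mult_ac)
      also have "\<dots> \<le> ?I * ennreal ((1 + \<bar>x\<bar>) powr (- \<alpha>\<^sub>2))"
        by (intro mult_right_mono weight_measure_singleton_le[OF assms(3)]) simp
      finally show "ennreal ((1 + \<bar>x\<bar>) powr (- \<alpha>)) * ennreal (cmod (v x)) \<le> ?I * ennreal ((1 + \<bar>x\<bar>) powr (- \<alpha>\<^sub>2))" .
    qed
    also have "\<dots> < \<infinity>"
      using D1(6) D2(6) by (simp add: nn_integral_cmult ennreal_mult_less_top)
    finally show ?thesis .
  qed
  have bounded_int: "integrable lborel (\<lambda>x. indicator A x * u x)" "integrable \<nu>\<^sub>2 (\<lambda>x. indicator A x * v x)"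
    if A: "A \<in> sets borel" "bounded A" for A
  proof -
    obtain C where C: "C \<ge> 0" "\<And>x. indicator A x \<le> C * (1 + \<bar>x\<bar>) powr (- \<alpha>)"
      using indicator_bounded_le_weight[OF A(2), of \<alpha>] assms(1,2) by (auto simp: \<alpha>_def)
    have C': "cmod (indicator A x) \<le> C * (1 + \<bar>x\<bar>) powr (- \<alpha>)" for x
      using C(2)[of x] by (auto simp: indicator_def)
    show "integrable lborel (\<lambda>x. indicator A x * u x)"
      by (rule integrable_weighted[OF _ _ u C(1) C' u_fin]) (use A in auto)
    show "integrable \<nu>\<^sub>2 (\<lambda>x. indicator A x * v x)"
      by (rule integrable_weighted[OF D2(1) _ v C(1) C' v_fin]) (use A in auto)
  qed

  \<comment> \<open>Lebesgue measure plays the first role, carrying \<open>u\<close>, and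
    \<open>\<nu>\<^sub>2\<close> the second, carrying the atoms in \<open>v\<close>.\<close>
  obtain \<nu> h where nu: "sets \<nu> = sets borel" and h: "h \<in> borel_measurable borel" "\<And>x. cmod (h x) = 1"
    and nn: "\<And>\<phi>. \<phi> \<in> borel_measurable borel \<Longrightarrow> (\<integral>\<^sup>+ x. \<phi> x \<partial>\<nu>) =
        (\<integral>\<^sup>+ x. \<phi> x * ennreal (cmod (u x)) \<partial>lborel) + (\<integral>\<^sup>+ x. \<phi> x * ennreal (cmod (v x)) \<partial>\<nu>\<^sub>2)"
    and int: "\<And>\<phi>. \<phi> \<in> borel_measurable borel \<Longrightarrow> integrable lborel (\<lambda>x. \<phi> x * u x) \<Longrightarrow> integrable \<nu>\<^sub>2 (\<lambda>x. \<phi> x * v x) \<Longrightarrow>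
       (\<integral>x. \<phi> x * h x \<partial>\<nu>) = (\<integral>x. \<phi> x * u x \<partial>lborel) + (\<integral>x. \<phi> x * v x \<partial>\<nu>\<^sub>2)"
    and pos: "(AE x in lborel. u x \<in> \<real>\<^sub>\<ge>\<^sub>0) \<Longrightarrow> (AE x in \<nu>\<^sub>2. v x \<in> \<real>\<^sub>\<ge>\<^sub>0) \<Longrightarrow> (AE x in \<nu>. h x = 1)"
    using polar_decomposition_sum[OF _ D2(1) u v v_null] by auto
  have nu_fin: "(\<integral>\<^sup>+ t. ennreal ((1 + \<bar>t\<bar>) powr (- \<alpha>)) \<partial>\<nu>) < \<infinity>"
    using u_fin v_fin by (subst nn) auto
  have "emeasure \<nu> K < \<infinity>" if K: "compact K" for K
  proof -
    obtain C where C: "C \<ge> 0" "\<And>x. indicator K x \<le> C * (1 + \<bar>x\<bar>) powr (- \<alpha>)"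
      using indicator_bounded_le_weight[OF compact_imp_bounded[OF K], of \<alpha>] assms(1,2) by (auto simp: \<alpha>_def)
    have "emeasure \<nu> K = (\<integral>\<^sup>+ x. ennreal (indicator K x) \<partial>\<nu>)"
      using K nu by (simp add: ennreal_indicator compact_imp_closed)
    also have "\<dots> \<le> (\<integral>\<^sup>+ x. ennreal C * ennreal ((1 + \<bar>x\<bar>) powr (- \<alpha>)) \<partial>\<nu>)"
      using C by (intro nn_integral_mono) (simp add: ennreal_mult[symmetric] ennreal_leI)
    also have "\<dots> < \<infinity>"
      using nu_fin nu by (simp add: nn_integral_cmult ennreal_mult_less_top cong: measurable_cong_sets)
    finally show ?thesis .
  qed
  then have M_nu: "M_alpha \<alpha> \<nu> h"
    unfolding M_alpha_def cradon_def using nu h nu_fin by auto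

  have cmeas: "cmeas \<nu> h A = (LINT \<tau>:A|lborel. u \<tau>) + (LINT \<tau>:A|\<nu>\<^sub>2. v \<tau>)"
    if A: "A \<in> sets borel" "bounded A" for A
  proof -
    have *: "indicator A x *\<^sub>R w = indicator A x * w" for x and w :: complex
      by (simp add: indicator_def)
    show ?thesis
      unfolding cmeas_def set_lebesgue_integral_def *
      by (rule int[OF _ bounded_int[OF A]]) (use A in auto)
  qed

  have cauchy: "cauchy_tr \<alpha>\<^sub>1 \<nu>\<^sub>1 h\<^sub>1 z * cauchy_tr \<alpha>\<^sub>2 \<nu>\<^sub>2 h\<^sub>2 z = cauchy_tr \<alpha> \<nu> h z" if z: "Im z > 0" for z
  proof -
    define \<phi> where "\<phi> \<equiv> \<lambda>t::real. (z + of_real t) powr (- of_real \<alpha>)"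
    define G where "G \<equiv> \<lambda>t. h\<^sub>1 t * (z + of_real t) powr (- of_real \<alpha>\<^sub>1)"
    define F where "F \<equiv> \<lambda>t. h\<^sub>2 t * (z + of_real t) powr (- of_real \<alpha>\<^sub>2)"
    have phi: "\<phi> \<in> borel_measurable borel"
      unfolding \<phi>_def by (rule borel_measurable_powr_upper_half_plane[OF z])
    have i1: "integrable lborel (\<lambda>\<tau>. d1 \<tau> * \<phi> \<tau>)" and
      e1: "(\<integral>\<tau>. d1 \<tau> * \<phi> \<tau> \<partial>lborel) = of_real B * (\<integral>t. (\<integral>s. indicator {..<t} s *\<^sub>R (G s * F t) \<partial>\<nu>\<^sub>1) \<partial>\<nu>\<^sub>2)"
      using T1.cauchy_dbl[OF z] unfolding d1_def \<phi>_def \<alpha>_def B_def G_def F_def by auto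
    have i2: "integrable lborel (\<lambda>\<tau>. d2 \<tau> * \<phi> \<tau>)" and
      e2: "(\<integral>\<tau>. d2 \<tau> * \<phi> \<tau> \<partial>lborel) = of_real B * (\<integral>s. (\<integral>t. indicator {..<s} t *\<^sub>R (F t * G s) \<partial>\<nu>\<^sub>2) \<partial>\<nu>\<^sub>1)"
      using T2.cauchy_dbl[OF z] unfolding d2_def \<phi>_def \<alpha>_def B G_def F_def add.commute[of \<alpha>\<^sub>2] by auto
    have u_phi: "\<phi> \<tau> * u \<tau> = (d1 \<tau> * \<phi> \<tau> + d2 \<tau> * \<phi> \<tau>) / of_real B" for \<tau>
      by (simp add: u_def field_simps)
    \<comment> \<open>Both kernels have the same nonzero base on the diagonal, so their principal
      powers multiply by adding exponents and no parametrisation formula enters.\<close>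
    have v_phi: "\<phi> \<tau> * v \<tau> = measure \<nu>\<^sub>1 {\<tau>} *\<^sub>R (G \<tau> * F \<tau>)" for \<tau>
    proof -
      have "z + of_real \<tau> \<noteq> 0" using z by (auto simp: complex_eq_iff)
      then have "\<phi> \<tau> = (z + of_real \<tau>) powr (- of_real \<alpha>\<^sub>1) * (z + of_real \<tau>) powr (- of_real \<alpha>\<^sub>2)"
        by (simp add: \<phi>_def \<alpha>_def powr_add[symmetric])
      then show ?thesis by (simp add: v_eq G_def F_def mult_ac)
    qed
    have iG: "integrable \<nu>\<^sub>1 G" unfolding G_def by (rule integrable_cauchy[OF assms(3,1) z])
    have iF: "integrable \<nu>\<^sub>2 F" unfolding F_def by (rule integrable_cauchy[OF assms(4,2) z])
    note split = integral_product_split_diagonal[OF D1(5) D2(5) D1(1) D2(1) D1(4) iF iG]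
    have "cauchy_tr \<alpha> \<nu> h z = (\<integral>t. \<phi> t * h t \<partial>\<nu>)"
      unfolding cauchy_tr_eq \<phi>_def by (simp add: mult.commute)
    also have "\<dots> = (\<integral>x. \<phi> x * u x \<partial>lborel) + (\<integral>x. \<phi> x * v x \<partial>\<nu>\<^sub>2)"
      by (rule int[OF phi]) (use i1 i2 split(2) in \<open>auto simp: u_phi v_phi\<close>)
    also have "\<dots> = (\<integral>t. (\<integral>s. indicator {..<t} s *\<^sub>R (G s * F t) \<partial>\<nu>\<^sub>1) \<partial>\<nu>\<^sub>2)
        + (\<integral>s. (\<integral>t. indicator {..<s} t *\<^sub>R (F t * G s) \<partial>\<nu>\<^sub>2) \<partial>\<nu>\<^sub>1)
        + (\<integral>t. measure \<nu>\<^sub>1 {t} *\<^sub>R (G t * F t) \<partial>\<nu>\<^sub>2)"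
      unfolding u_phi v_phi using i1 i2 B by (simp add: e1 e2 add_divide_distrib)
    also have "\<dots> = (\<integral>s. G s \<partial>\<nu>\<^sub>1) * (\<integral>t. F t \<partial>\<nu>\<^sub>2)"
      by (rule split(1)[symmetric]) auto
    finally show ?thesis unfolding cauchy_tr_eq G_def F_def by simp
  qed

  have positive: "AE x in \<nu>. h x = 1" if one: "AE x in \<nu>\<^sub>1. h\<^sub>1 x = 1" "AE x in \<nu>\<^sub>2. h\<^sub>2 x = 1"
  proof (rule pos)
    have "u x \<in> \<real>\<^sub>\<ge>\<^sub>0" for x
      unfolding u_def d1_def d2_def using B T1.dbl_nonneg[OF one] T2.dbl_nonneg[OF one(2,1)]
      by (intro nonneg_Reals_divide_I nonneg_Reals_add_I) auto
    then show "AE x in lborel. u x \<in> \<real>\<^sub>\<ge>\<^sub>0" by simp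
    \<comment> \<open>The phase of the first measure is 1 only almost everywhere, but a point of
      positive mass cannot lie in a null set.\<close>
    have atom: "h\<^sub>1 x = 1" if "measure \<nu>\<^sub>1 {x} \<noteq> 0" for x
    proof (rule ccontr)
      assume "h\<^sub>1 x \<noteq> 1"
      then have "AE y in \<nu>\<^sub>1. y \<noteq> x" using one(1) by (auto elim!: eventually_mono)
      then have "emeasure \<nu>\<^sub>1 {x} = 0"
        using D1(1) by (subst (asm) AE_iff_measurable[of "{x}"]) (auto simp: sets_eq_imp_space_eq[OF D1(1)])
      with that show False by (simp add: measure_def)
    qed
    show "AE x in \<nu>\<^sub>2. v x \<in> \<real>\<^sub>\<ge>\<^sub>0"
      using one(2)
    proof eventually_elim
      case (elim x)
      then have "v x = of_real (measure \<nu>\<^sub>1 {x})"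
        using atom[of x] by (cases "measure \<nu>\<^sub>1 {x} = 0") (auto simp: v_eq scaleR_conv_of_real)
      then show ?case by simp
    qed
  qed

  have set_int: "\<forall>A \<in> sets borel. bounded A \<longrightarrow> set_integrable lborel A u"
  proof (intro ballI impI)
    fix A :: "real set"
    assume "A \<in> sets borel" "bounded A"
    moreover have "indicator A x *\<^sub>R u x = indicator A x * u x" for x
      by (simp add: indicator_def)
    ultimately show "set_integrable lborel A u"
      unfolding set_integrable_def using bounded_int(1) by simp
  qed
  have u_eq: "AE \<tau> in lborel. complex_of_real (Beta \<alpha>\<^sub>1 \<alpha>\<^sub>2) * u \<tau> =
          dbl \<alpha>\<^sub>1 \<alpha>\<^sub>2 \<nu>\<^sub>1 h\<^sub>1 \<nu>\<^sub>2 h\<^sub>2 \<tau> + dbl \<alpha>\<^sub>2 \<alpha>\<^sub>1 \<nu>\<^sub>2 h\<^sub>2 \<nu>\<^sub>1 h\<^sub>1 \<tau>"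
    using B(1) by (simp add: u_def d1_def d2_def B_def)
  show ?thesis
    using M_nu cmeas cauchy positive unfolding \<alpha>_def v_def
    by (intro exI[where x = u] conjI u set_int u_eq) blast
qed

end
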